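(* Let $P(z)=\sum_{n\ge0}P_nz^n$ be the unique formal power series with $P=1+\frac{zP^2}{1-z^3P^2}$, and let $Q(z)=1+\frac{zP^2}{1-z^3P^3}=\sum_{n\ge0}Q_nz^n$. Let $\rho$ be the least positive root of $4z^7-12z^5-8z^4+12z^3-20z^2+1$, let $\nu$ be the least positive root of $y^7-2y^6-4y^4+4y^3+4y-2$, and set $$\gamma_P=\frac12\sqrt{\frac{\nu^3-2\rho\nu^2+1}{\rho(3\rho\nu-\rho^2+1)}},\qquad \gamma_Q=\frac{\nu(\nu^3+2)}{(\nu^3-1)^2}\gamma_P .$$ Then: (i) $P(z)$ and $Q(z)$ both have radius of convergence $\rho$. (ii) At $z=\rho$, $P$ and $Q$ have finite values, $P(\rho)=\nu/\rho$ and $Q(\rho)=1+\nu^2/\big(\rho(1-\nu^3)\big)$, but infinite first derivatives. (iii) As $n\to\infty$, $$P_n=\frac{\gamma_P\rho^{-n}}{\sqrt\pi\,n^{3/2}}\Big(1+O\big(\tfrac1n\big)\Big),\qquad Q_n=\frac{\gamma_Q\rho^{-n}}{\sqrt\pi\,n^{3/2}}\Big(1+O\big(\tfrac1n\big)\Big).$$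
   Context: Numerically $\rho\approx0.237287$, $\nu\approx0.452578$. *)

theory Defs
  imports "HOL-Analysis.Analysis" "HOL-Library.Landau_Symbols"
begin

definition P_ser :: "real fps" where
  "P_ser = (THE P. P = 1 + fps_X * P^2 / (1 - fps_X^3 * P^2))"

definition Q_ser :: "real fps" where
  "Q_ser = 1 + fps_X * P_ser^2 / (1 - fps_X^3 * P_ser^3)"

definition rho :: real where
  "rho = (LEAST z. 0 < z \<and> 4*z^7 - 12*z^5 - 8*z^4 + 12*z^3 - 20*z^2 + 1 = 0)"

definition nu :: real where
  "nu = (LEAST y. 0 < y \<and> y^7 - 2*y^6 - 4*y^4 + 4*y^3 + 4*y - 2 = 0)"

definition gamma_P :: real where
  "gamma_P = 1/2 * sqrt ((nu^3 - 2*rho*nu^2 + 1) / (rho * (3*rho*nu - rho^2 + 1)))"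

definition gamma_Q :: real where
  "gamma_Q = nu * (nu^3 + 2) / (nu^3 - 1)^2 * gamma_P"

text \<open>
  Here \<open>a\<close> is the right end point of the interval of convergence, so only left limits make
  sense. ``The derivative at \<open>a\<close> is infinite'' is read in both usual ways.
\<close>

definition infinite_deriv_at_left :: "(real \<Rightarrow> real) \<Rightarrow> real \<Rightarrow> bool" where
  "infinite_deriv_at_left f a \<longleftrightarrow>
     filterlim (\<lambda>x. (f x - f a) / (x - a)) at_top (at_left a) \<and>
     filterlim (deriv f) at_top (at_left a)"

lemma fps_contraction_ex1:
  fixes F :: "'a::zero fps \<Rightarrow> 'a fps"
  assumes step: "\<And>A B n. (\<And>k. k < n \<Longrightarrow> fps_nth A k = fps_nth B k) \<Longrightarrow>
                    (\<And>k. k \<le> n \<Longrightarrow> fps_nth (F A) k = fps_nth (F B) k)"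
  shows "\<exists>!A. A = F A"
proof -
  define S where "S = (\<lambda>m. (F ^^ m) 0)"
  have S_Suc: "S (Suc m) = F (S m)" for m
    by (simp add: S_def)
  have agree1: "fps_nth (S (Suc m)) k = fps_nth (S m) k" if "k < m" for m k
    using that
  proof (induction m arbitrary: k)
    case 0
    then show ?case by simp
  next
    case (Suc m)
    have "fps_nth (F (S (Suc m))) k = fps_nth (F (S m)) k"
      by (rule step[of m]) (use Suc in auto)
    then show ?case by (simp add: S_Suc)
  qed
  have agree: "fps_nth (S (m + d)) k = fps_nth (S m) k" if "k < m" for m d k
    using that by (induction d) (auto simp: agree1)
  define A where "A = Abs_fps (\<lambda>k. fps_nth (S (Suc k)) k)"
  have A_nth: "fps_nth A k = fps_nth (S m) k" if "k < m" for k m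
    using agree[of k "Suc k" "m - Suc k"] that by (simp add: A_def)
  have "A = F A"
  proof (rule fps_ext)
    fix k
    have "fps_nth (F A) k = fps_nth (F (S k)) k"
      by (rule step[of k]) (auto intro: A_nth)
    also have "\<dots> = fps_nth A k"
      using A_nth[of k "Suc k"] by (simp add: S_Suc)
    finally show "fps_nth A k = fps_nth (F A) k" by simp
  qed
  moreover have "B = A" if B: "B = F B" for B
  proof (rule fps_ext)
    fix n
    show "fps_nth B n = fps_nth A n"
    proof (induction n rule: less_induct)
      case (less n)
      have "fps_nth (F B) n = fps_nth (F A) n"
        by (rule step[of n]) (use less in auto)
      then show ?case using B \<open>A = F A\<close> by simp
    qed
  qed
  ultimately show ?thesis by blast
qed

lemma fps_nth_mult_cong:
  fixes A B C D :: "'a::semiring_0 fps"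
  assumes "\<And>k. k < n \<Longrightarrow> fps_nth A k = fps_nth B k"
      and "\<And>k. k < n \<Longrightarrow> fps_nth C k = fps_nth D k"
      and "k < n"
  shows "fps_nth (A * C) k = fps_nth (B * D) k"
  unfolding fps_mult_nth using assms by (intro sum.cong) auto

lemma fps_nth_inverse_cong:
  fixes A B :: "'a::field fps"
  assumes "\<And>k. k < n \<Longrightarrow> fps_nth A k = fps_nth B k" and "k < n"
  shows "fps_nth (inverse A) k = fps_nth (inverse B) k"
  using assms(2)
proof (induction k rule: less_induct)
  case (less k)
  show ?case
  proof (cases k)
    case 0
    then show ?thesis using less assms(1)[of 0] by simp
  next
    case (Suc m)
    have "(\<Sum>i = 1..k. fps_nth A i * fps_nth (inverse A) (k - i)) =
          (\<Sum>i = 1..k. fps_nth B i * fps_nth (inverse B) (k - i))"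
      using less assms(1) by (intro sum.cong) auto
    moreover have "fps_nth A 0 = fps_nth B 0"
      using less.prems assms(1)[of 0] by simp
    ultimately show ?thesis
      using Suc by (simp add: fps_inverse_def)
  qed
qed

lemma P_ser_ex1: "\<exists>!P :: real fps. P = 1 + fps_X * P^2 / (1 - fps_X^3 * P^2)"
proof (rule fps_contraction_ex1)
  fix A B :: "real fps" and n k :: nat
  assume agr: "\<And>k. k < n \<Longrightarrow> fps_nth A k = fps_nth B k" and "k \<le> n"
  define G :: "real fps \<Rightarrow> real fps" where "G = (\<lambda>P. P^2 * inverse (1 - fps_X^3 * P^2))"
  have eq: "1 + fps_X * P^2 / (1 - fps_X^3 * P^2) = 1 + fps_X * G P" for P :: "real fps"
    by (simp add: G_def fps_divide_unit mult.assoc)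
  have sq: "fps_nth (A^2) j = fps_nth (B^2) j" if "j < n" for j
    unfolding power2_eq_square using agr that by (intro fps_nth_mult_cong[of n]) auto
  have den: "fps_nth (1 - fps_X^3 * A^2) j = fps_nth (1 - fps_X^3 * B^2) j" if "j < n" for j
    using sq that by (simp add: fps_X_power_mult_nth)
  have "fps_nth (G A) j = fps_nth (G B) j" if "j < n" for j
    unfolding G_def
    using sq den that by (intro fps_nth_mult_cong[of n] fps_nth_inverse_cong[of n]) auto
  then show "fps_nth (1 + fps_X * A^2 / (1 - fps_X^3 * A^2)) k =
             fps_nth (1 + fps_X * B^2 / (1 - fps_X^3 * B^2)) k"
    unfolding eq using \<open>k \<le> n\<close> by simp
qed

lemma P_ser_eq: "P_ser = 1 + fps_X * P_ser^2 / (1 - fps_X^3 * P_ser^2)"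
  unfolding P_ser_def by (rule theI'[OF P_ser_ex1])

lemma least_pos_root:
  fixes p :: "real poly"
  assumes "p \<noteq> 0" and "0 < x" and "poly p x = 0"
  defines "r \<equiv> (LEAST z. 0 < z \<and> poly p z = 0)"
  shows "0 < r" and "poly p r = 0" and "\<And>z. 0 < z \<Longrightarrow> poly p z = 0 \<Longrightarrow> r \<le> z"
proof -
  define S where "S = {z. 0 < z \<and> poly p z = 0}"
  have fin: "finite S"
    using poly_roots_finite[OF \<open>p \<noteq> 0\<close>] by (rule rev_finite_subset) (auto simp: S_def)
  have "S \<noteq> {}" using assms by (auto simp: S_def)
  then have "Min S \<in> S" using fin by (rule Min_in[rotated])
  then have r: "r = Min S"
    unfolding r_def using fin by (intro Least_equality) (auto simp: S_def)
  show "0 < r" "poly p r = 0"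
    using \<open>Min S \<in> S\<close> r by (auto simp: S_def)
  show "r \<le> z" if "0 < z" "poly p z = 0" for z
    using that fin r by (auto simp: S_def)
qed

lemma rho_least:
  shows "0 < rho" and "4*rho^7 - 12*rho^5 - 8*rho^4 + 12*rho^3 - 20*rho^2 + 1 = 0"
    and "\<And>z. 0 < z \<Longrightarrow> 4*z^7 - 12*z^5 - 8*z^4 + 12*z^3 - 20*z^2 + 1 = 0 \<Longrightarrow> rho \<le> z"
proof -
  define p :: "real poly" where "p = [:1, 0, -20, 12, -8, -12, 0, 4:]"
  have p: "poly p z = 4*z^7 - 12*z^5 - 8*z^4 + 12*z^3 - 20*z^2 + 1" for z
    by (simp add: p_def algebra_simps eval_nat_numeral)
  have "\<exists>x>0. x < 1 \<and> poly p x = 0"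
    by (rule poly_IVT_neg) (simp_all add: p)
  then obtain x where x: "0 < x" "poly p x = 0" by blast
  have "p \<noteq> 0" by (simp add: p_def)
  note * = least_pos_root[OF this x, unfolded p, folded rho_def]
  show "0 < rho" "4*rho^7 - 12*rho^5 - 8*rho^4 + 12*rho^3 - 20*rho^2 + 1 = 0"
    using * by auto
  show "rho \<le> z" if "0 < z" "4*z^7 - 12*z^5 - 8*z^4 + 12*z^3 - 20*z^2 + 1 = 0" for z
    using *(3) that by auto
qed

lemma nu_least:
  shows "0 < nu" and "nu^7 - 2*nu^6 - 4*nu^4 + 4*nu^3 + 4*nu - 2 = 0"
    and "\<And>y. 0 < y \<Longrightarrow> y^7 - 2*y^6 - 4*y^4 + 4*y^3 + 4*y - 2 = 0 \<Longrightarrow> nu \<le> y"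
proof -
  define p :: "real poly" where "p = [:-2, 4, 0, 4, -4, 0, -2, 1:]"
  have p: "poly p y = y^7 - 2*y^6 - 4*y^4 + 4*y^3 + 4*y - 2" for y
    by (simp add: p_def algebra_simps eval_nat_numeral)
  have "\<exists>x>0. x < 1 \<and> poly p x = 0"
    by (rule poly_IVT_pos) (simp_all add: p)
  then obtain x where x: "0 < x" "poly p x = 0" by blast
  have "p \<noteq> 0" by (simp add: p_def)
  note * = least_pos_root[OF this x, unfolded p, folded nu_def]
  show "0 < nu" "nu^7 - 2*nu^6 - 4*nu^4 + 4*nu^3 + 4*nu - 2 = 0"
    using * by auto
  show "nu \<le> y" if "0 < y" "y^7 - 2*y^6 - 4*y^4 + 4*y^3 + 4*y - 2 = 0" for y
    using *(3) that by auto
qed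

end

theory Submission
  imports Defs "HOL-Complex_Analysis.Complex_Analysis" "HOL-Probability.Probability"
    "HOL-Real_Asymp.Real_Asymp"
begin

text \<open>
  Put \<open>y = z P(z)\<close>. The functional equation becomes \<open>(y - z) (1 - z y\<^sup>2) = y\<^sup>2\<close>, which is quadratic in
  \<open>z\<close>, so the inverse function \<open>z = \<zeta>(y)\<close> is explicit and holomorphic for \<open>\<bar>y\<bar> < 1/2\<close>, and
  \<open>z Q(z) = z + y\<^sup>2 / (1 - y\<^sup>3)\<close>. By Lagrange inversion the coefficients of a function \<open>H(y)\<close> of \<open>z\<close> are
  \<open>n [z\<^sup>n] H(y(z)) = (1 / 2\<pi>i) \<oint> H'(y) \<zeta>(y)\<^bsup>-n\<^esup> dy\<close>. On the circle \<open>\<bar>y\<bar> = \<nu>\<close> through the critical point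
  \<open>\<nu>\<close> of \<open>\<zeta>\<close>, the equality case of the triangle inequality shows that \<open>\<bar>\<zeta>\<bar>\<close> exceeds \<open>\<rho> = \<zeta>(\<nu>)\<close>
  except at \<open>\<nu>\<close>, so Laplace's method yields (iii). The \<open>n\<^bsup>-3/2\<^esup> \<rho>\<^bsup>-n\<^esup>\<close> behaviour implies the radius of
  convergence, continuity up to \<open>\<rho>\<close> and the infinite derivatives; the values at \<open>\<rho>\<close> are then
  determined by the functional equations.
\<close>

section \<open>Laplace's method for conjugation-symmetric integrands\<close>

text \<open>Nothing is known in advance about the analytic behaviour of y(z) near \<rho>, so all
  analysis takes place in the variable y, where \<open>zeta\<close> is explicit; z enters only
  through formal power series, and even the radius of convergence is read off from the coefficient
  asymptotics. The relative error O(1/n) shapes the Laplace estimate. On a half line with the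
  maximum at the end point, terms of order t and n t^3 would leave a relative error of n^(-1/2). The
  integrands here satisfy f(-t) = cnj (f t), which makes these odd terms purely imaginary, so the
  real part is one order better. The radius 1/2 exceeds \<nu>, yet |y| < 1/2 still keeps the
  discriminant off the branch cut and 1 - y, 1 - y^3 away from 0: one disc serves every function
  involved. With F(y,z) = (y - z)(1 - z y^2) - y^2, the critical point satisfies F = F_y = 0. Since
  2 F - y F_y = y - z (2 - y^3), this gives \<rho> (2 - \<nu>^3) = \<nu>, the link between two
  numbers defined by separate polynomials.\<close>

lemma has_integral_gaussian_half_line:
  fixes a :: real
  assumes "a > 0"
  shows "((\<lambda>x. exp (- (a * x\<^sup>2))) has_integral (sqrt (pi / a) / 2)) {0..}"
proof -
  have "has_bochner_integral lborel
          (\<lambda>x. indicator {0..} (0 + sqrt a * x) *\<^sub>R exp (- (0 + sqrt a * x)\<^sup>2)) ((sqrt pi / 2) /\<^sub>R \<bar>sqrt a\<bar>)"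
    using lborel_has_bochner_integral_real_affine_iff[of "sqrt a" "\<lambda>x. indicator {0..} x *\<^sub>R exp (- x\<^sup>2)" "sqrt pi / 2" 0]
      gaussian_moment_0 assms by simp
  then have "((\<lambda>x. indicator {0..} (0 + sqrt a * x) *\<^sub>R exp (- (0 + sqrt a * x)\<^sup>2)) has_integral ((sqrt pi / 2) /\<^sub>R \<bar>sqrt a\<bar>)) UNIV"
    (is "(?f has_integral ?I) _")
  proof -
    assume "has_bochner_integral lborel ?f ?I"
    then have "integrable lborel ?f" "integral\<^sup>L lborel ?f = ?I"
      unfolding has_bochner_integral_iff by blast+
    then show "(?f has_integral ?I) UNIV"
      using has_integral_integral_lborel[of ?f] by (simp only:)
  qed
  also have "(\<lambda>x. indicator {0..} (0 + sqrt a * x) *\<^sub>R exp (- (0 + sqrt a * x)\<^sup>2)) =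
      (\<lambda>x. if x \<in> {0..} then exp (- (a * x\<^sup>2)) else 0)"
    using assms by (auto simp: fun_eq_iff indicator_def power_mult_distrib zero_le_mult_iff)
  also have "(sqrt pi / 2) /\<^sub>R \<bar>sqrt a\<bar> = sqrt (pi / a) / 2"
    using assms by (simp add: real_sqrt_divide field_simps)
  finally show ?thesis
    by (simp only: has_integral_restrict_UNIV)
qed

text \<open>Meant for z = O(t^3): the linear term n z is kept exactly, so that its real part can be
  exploited later, and exp(n |z|) will be absorbed by part of the Gaussian decay. The induction
  closes for the sharper factor (1 + |z|)^n, because n^2 + n \<le> (n + 1)^2.\<close>

lemma power_one_plus_linear_approx:
  fixes z :: "'a :: {real_normed_field}"
  shows "norm ((1 + z) ^ n - 1 - of_nat n * z) \<le> (real n * norm z)\<^sup>2 * exp (real n * norm z)"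
proof -
  have "norm ((1 + z) ^ n - 1 - of_nat n * z) \<le> (real n * norm z)\<^sup>2 * (1 + norm z) ^ n"
  proof (induction n)
    case (Suc n)
    have "(1 + z) ^ Suc n - 1 - of_nat (Suc n) * z =
        (1 + z) * ((1 + z) ^ n - 1 - of_nat n * z) + of_nat n * z\<^sup>2"
      by (simp add: algebra_simps power2_eq_square)
    also have "norm \<dots> \<le> norm (1 + z) * norm ((1 + z) ^ n - 1 - of_nat n * z) + real n * (norm z)\<^sup>2"
      by (rule order.trans[OF norm_triangle_ineq]) (simp add: norm_mult norm_power)
    also have "\<dots> \<le> (1 + norm z) * ((real n * norm z)\<^sup>2 * (1 + norm z) ^ n) + real n * (norm z)\<^sup>2 * (1 + norm z) ^ Suc n"
    proof (rule add_mono[OF mult_mono])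
      show "norm (1 + z) \<le> 1 + norm z"
        using norm_triangle_ineq[of 1 z] by simp
      have "(1::real) \<le> (1 + norm z) ^ Suc n"
        by (rule one_le_power) simp
      then show "real n * (norm z)\<^sup>2 \<le> real n * (norm z)\<^sup>2 * (1 + norm z) ^ Suc n"
        using mult_left_mono[of 1 "(1 + norm z) ^ Suc n" "real n * (norm z)\<^sup>2"] by simp
    qed (use Suc in auto)
    also have "\<dots> = (real n ^ 2 + real n) * ((norm z)\<^sup>2 * (1 + norm z) ^ Suc n)"
      by (simp add: algebra_simps power2_eq_square)
    also have "\<dots> \<le> (real (Suc n))\<^sup>2 * ((norm z)\<^sup>2 * (1 + norm z) ^ Suc n)"
      by (intro mult_right_mono) (auto simp: power2_eq_square algebra_simps)
    finally show ?case
      by (simp add: power_mult_distrib mult_ac)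
  qed auto
  also have "(1 + norm z) ^ n \<le> exp (norm z) ^ n"
    by (intro power_mono exp_ge_add_one_self) auto
  hence "(real n * norm z)\<^sup>2 * (1 + norm z) ^ n \<le> (real n * norm z)\<^sup>2 * exp (real n * norm z)"
    by (intro mult_left_mono) (auto simp: exp_of_nat_mult)
  finally show ?thesis .
qed

text \<open>The remainder is w^m times the power series shifted by m places; the latter is
  continuous, hence bounded, on the compact disc of radius s.\<close>

lemma holomorphic_Taylor_remainder_bound:
  fixes f :: "complex \<Rightarrow> complex"
  assumes "f holomorphic_on ball 0 r" "0 < s" "s < r"
  obtains C where "C > 0"
    "\<And>w. norm w \<le> s \<Longrightarrow> norm (f w - (\<Sum>k<m. (deriv ^^ k) f 0 / fact k * w ^ k)) \<le> C * norm w ^ m"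
proof -
  define F where "F = fps_expansion f 0"
  have R: "fps_conv_radius F \<ge> r"
    unfolding F_def using conv_radius_fps_expansion[of f 0 r] assms by simp
  define k where "k = eval_fps (fps_shift m F)"
  have R': "fps_conv_radius (fps_shift m F) \<ge> r"
    using R by simp
  have ev: "eval_fps F w = f w" if "norm w \<le> s" for w
    unfolding F_def using eval_fps_expansion[of f 0 r w] assms that by auto
  have sub: "cball 0 s \<subseteq> eball (0::complex) (fps_conv_radius (fps_shift m F))"
    using order.strict_trans2[OF _ R', of "ereal _"] assms
    by (auto simp: subset_iff simp del: fps_conv_radius_shift)
  have "continuous_on (cball 0 s) k"
    unfolding k_def by (rule continuous_on_subset[OF continuous_on_eval_fps sub])
  then have "bounded (k ` cball 0 s)"
    by (intro compact_imp_bounded compact_continuous_image) auto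
  then obtain C where C: "C > 0" "\<And>w. norm w \<le> s \<Longrightarrow> norm (k w) \<le> C"
    by (auto simp: bounded_pos)
  have eq: "f w - (\<Sum>k<m. (deriv ^^ k) f 0 / fact k * w ^ k) = k w * w ^ m" if w: "norm w \<le> s" for w
  proof -
    have "ereal (norm w) < fps_conv_radius F"
      using w assms by (intro less_le_trans[OF _ R]) simp
    then have sm: "summable (\<lambda>n. fps_nth F n * w ^ n)"
      by (rule summable_fps)
    have "f w = (\<Sum>n. fps_nth F n * w ^ n)"
      using ev[OF w] by (simp add: eval_fps_def)
    also have "\<dots> = (\<Sum>n. fps_nth F (n + m) * w ^ (n + m)) + (\<Sum>n<m. fps_nth F n * w ^ n)"
      by (rule suminf_split_initial_segment[OF sm])
    also have "(\<Sum>n. fps_nth F (n + m) * w ^ (n + m)) = (\<Sum>n. fps_nth F (n + m) * w ^ n * w ^ m)"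
      by (simp add: power_add mult_ac)
    also have "\<dots> = k w * w ^ m"
      unfolding k_def eval_fps_def
      using suminf_mult2[OF summable_fps[OF less_le_trans[OF _ R']], of w "w ^ m"] w assms
      by simp
    finally show ?thesis
      by (simp add: F_def fps_expansion_def)
  qed
  show ?thesis
  proof (rule that[OF C(1)])
    fix w :: complex assume w: "norm w \<le> s"
    show "norm (f w - (\<Sum>k<m. (deriv ^^ k) f 0 / fact k * w ^ k)) \<le> C * norm w ^ m"
      unfolding eq[OF w] using C(2)[OF w] by (auto simp: norm_mult norm_power intro!: mult_right_mono)
  qed
qed

text \<open>For \<open>f\<close> with \<open>f (- t) = cnj (f t)\<close> the real part is the even part of \<open>f\<close> along the
  real axis, so an odd-order leading Taylor term does not contribute to it.\<close>

lemma Re_even_Taylor_bound: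
  fixes f :: "complex \<Rightarrow> complex"
  assumes holo: "f holomorphic_on ball 0 r" and s: "0 < s" "s < r"
    and sym: "\<And>t::real. \<bar>t\<bar> < r \<Longrightarrow> f (of_real (-t)) = cnj (f (of_real t))"
    and vanish: "\<And>k. 0 < k \<Longrightarrow> k < m \<Longrightarrow> (deriv ^^ k) f 0 = 0" and m: "odd m"
  obtains C where "C > 0"
    "\<And>t::real. \<bar>t\<bar> \<le> s \<Longrightarrow> norm (f (of_real t) - f 0) \<le> C * \<bar>t\<bar> ^ m"
    "\<And>t::real. \<bar>t\<bar> \<le> s \<Longrightarrow> \<bar>Re (f (of_real t)) - Re (f 0)\<bar> \<le> C * \<bar>t\<bar> ^ (m + 1)"
proof -
  have sum_eq: "(\<Sum>k<m. (deriv ^^ k) f 0 / fact k * w ^ k) = f 0" for w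
  proof -
    have "(\<Sum>k<m. (deriv ^^ k) f 0 / fact k * w ^ k) = (\<Sum>k\<in>{0}. (deriv ^^ k) f 0 / fact k * w ^ k)"
      using m by (intro sum.mono_neutral_right) (auto simp: vanish elim: oddE)
    then show ?thesis by simp
  qed
  obtain C1 where C1: "C1 > 0"
    "\<And>w. norm w \<le> s \<Longrightarrow> norm (f w - (\<Sum>k<m. (deriv ^^ k) f 0 / fact k * w ^ k)) \<le> C1 * norm w ^ m"
    using holomorphic_Taylor_remainder_bound[OF holo s, of m] by blast
  obtain C2 where C2: "C2 > 0"
    "\<And>w. norm w \<le> s \<Longrightarrow> norm (f w - (\<Sum>k<m+1. (deriv ^^ k) f 0 / fact k * w ^ k)) \<le> C2 * norm w ^ (m + 1)"
    using holomorphic_Taylor_remainder_bound[OF holo s, of "m+1"] by blast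
  define a where "a = (deriv ^^ m) f 0 / fact m"
  have sum_Suc: "(\<Sum>k<m+1. (deriv ^^ k) f 0 / fact k * w ^ k) = f 0 + a * w ^ m" for w
    by (simp only: Suc_eq_plus1[symmetric] sum.lessThan_Suc sum_eq a_def)
  show ?thesis
  proof (rule that[of "C1 + C2"])
    show "C1 + C2 > 0" using C1 C2 by simp
  next
    fix t :: real assume t: "\<bar>t\<bar> \<le> s"
    have "norm (f (of_real t) - f 0) \<le> C1 * \<bar>t\<bar> ^ m"
      using C1(2)[of "of_real t"] t unfolding sum_eq by simp
    also have "\<dots> \<le> (C1 + C2) * \<bar>t\<bar> ^ m"
      using C2(1) by (intro mult_right_mono) auto
    finally show "norm (f (of_real t) - f 0) \<le> (C1 + C2) * \<bar>t\<bar> ^ m" .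
  next
    fix t :: real assume t: "\<bar>t\<bar> \<le> s"
    have 1: "norm (f (of_real t) - f 0 - a * of_real t ^ m) \<le> C2 * \<bar>t\<bar> ^ (m + 1)"
      using C2(2)[of "of_real t"] t unfolding sum_eq sum_Suc a_def[symmetric] by (simp add: algebra_simps)
    have 2: "norm (f (of_real (-t)) - f 0 + a * of_real t ^ m) \<le> C2 * \<bar>t\<bar> ^ (m + 1)"
      using C2(2)[of "of_real (-t)"] t m unfolding sum_eq sum_Suc a_def[symmetric] by (simp add: algebra_simps)
    have "2 * \<bar>Re (f (of_real t)) - Re (f 0)\<bar> = norm (f (of_real t) + f (of_real (-t)) - 2 * of_real (Re (f 0)))"
    proof -
      have "f (of_real t) + f (of_real (-t)) - 2 * of_real (Re (f 0)) =
          complex_of_real (2 * (Re (f (of_real t)) - Re (f 0)))"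
        using sym[of t] t s by (simp add: complex_eq_iff)
      then show ?thesis by (simp only: norm_of_real abs_mult abs_numeral)
    qed
    also have "of_real (Re (f 0)) = f 0"
    proof -
      have "f 0 = cnj (f 0)" using sym[of 0] s by simp
      then have "Im (f 0) = - Im (f 0)" by (metis cnj.simps(2))
      then show ?thesis by (simp add: complex_eq_iff)
    qed
    also have "f (of_real t) + f (of_real (-t)) - 2 * f 0 =
        (f (of_real t) - f 0 - a * of_real t ^ m) + (f (of_real (-t)) - f 0 + a * of_real t ^ m)"
      by simp
    also have "norm \<dots> \<le> C2 * \<bar>t\<bar> ^ (m + 1) + C2 * \<bar>t\<bar> ^ (m + 1)"
      by (rule norm_triangle_le) (intro add_mono 1 2)
    finally have "\<bar>Re (f (of_real t)) - Re (f 0)\<bar> \<le> C2 * \<bar>t\<bar> ^ (m + 1)" by simp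
    also have "\<dots> \<le> (C1 + C2) * \<bar>t\<bar> ^ (m + 1)"
      using C1(1) by (intro mult_right_mono) auto
    finally show "\<bar>Re (f (of_real t)) - Re (f 0)\<bar> \<le> (C1 + C2) * \<bar>t\<bar> ^ (m + 1)" .
  qed
qed

text \<open>From u \<le> exp u with u = c x / 3 one gets u^k \<le> exp (k u) \<le> exp (c x) for k
  \<le> 3; this is where the 3 in 3 / c comes from.\<close>

lemma polynomial_le_exp:
  fixes c x :: real
  assumes "c > 0" "x \<ge> 0"
  shows "x + x^2 + x^3 \<le> (3 / c + (3 / c)^2 + (3 / c)^3) * exp (c * x)"
proof -
  have pow: "x ^ k \<le> (3 / c) ^ k * exp (c * x)" if "k \<le> 3" for k
  proof -
    have "c * x / 3 \<le> exp (c * x / 3)"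
      using exp_ge_add_one_self[of "c * x / 3"] by linarith
    then have "(c * x / 3) ^ k \<le> exp (c * x / 3) ^ k"
      using assms by (intro power_mono) auto
    also have "\<dots> = exp (real k * (c * x / 3))"
      by (simp only: exp_of_nat_mult)
    also have "\<dots> \<le> exp (c * x)"
    proof -
      have "real k * (c * x / 3) \<le> 3 * (c * x / 3)"
        using assms that by (intro mult_right_mono) auto
      then show ?thesis by simp
    qed
    finally have "(3 / c) ^ k * (c * x / 3) ^ k \<le> (3 / c) ^ k * exp (c * x)"
      using assms by (intro mult_left_mono) auto
    then show ?thesis
      using assms by (simp flip: power_mult_distrib)
  qed
  show ?thesis
    using pow[of 1] pow[of 2] pow[of 3] by (simp add: distrib_right)
qed

text \<open>Write h(w) = (1 + p(w)) exp(-\<kappa> w^2 / 2), where p vanishes to third order, and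
  expand (1 + p)^n to first order. By symmetry Re g differs from its value at 0 by O(t^2) and Re (g
  p) is O(t^4), not merely O(t) and O(t^3). The three error terms come from g, from n g p and from
  the quadratic remainder; with x = n t^2 they are (x + x^2 + x^3) / n.\<close>

lemma Laplace_pointwise_bound:
  fixes g h h' :: "complex \<Rightarrow> complex" and \<kappa> :: real
  assumes r: "r > 0" and \<kappa>: "\<kappa> > 0"
    and g: "g holomorphic_on ball 0 r"
    and g_sym: "\<And>t::real. \<bar>t\<bar> < r \<Longrightarrow> g (of_real (-t)) = cnj (g (of_real t))"
    and h_sym: "\<And>t::real. \<bar>t\<bar> < r \<Longrightarrow> h (of_real (-t)) = cnj (h (of_real t))"
    and h0: "h 0 = 1"
    and h': "\<And>w. w \<in> ball 0 r \<Longrightarrow> (h has_field_derivative h' w) (at w)" and h'0: "h' 0 = 0"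
    and h'': "(h' has_field_derivative - of_real \<kappa>) (at 0)"
  obtains \<delta> K where "0 < \<delta>" "\<delta> < r" "K > 0"
    "\<And>t n. 0 \<le> t \<Longrightarrow> t \<le> \<delta> \<Longrightarrow>
       \<bar>Re (g (of_real t) * h (of_real t) ^ n) - Re (g 0) * exp (- (real n * \<kappa> / 2 * t^2))\<bar> \<le>
       K * (t^2 + real n * t^4 + real n ^ 2 * t^6) * exp (- (real n * \<kappa> / 4 * t^2))"
proof -
  define E where "E = (\<lambda>w::complex. exp (of_real (\<kappa> / 2) * w^2))"
  define p where "p = (\<lambda>w. h w * E w - 1)"
  define p' where "p' = (\<lambda>w. (h' w + of_real \<kappa> * w * h w) * E w)"
  have E': "(E has_field_derivative of_real \<kappa> * w * E w) (at w)" for w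
    unfolding E_def by (auto intro!: derivative_eq_intros)
  have p_deriv: "(p has_field_derivative p' w) (at w)" if "w \<in> ball 0 r" for w
    unfolding p_def p'_def
    using DERIV_diff[OF DERIV_mult[OF h'[OF that] E'[of w]] DERIV_const[of 1]] by (simp add: algebra_simps)
  have p'_deriv: "(p' has_field_derivative 0) (at 0)"
  proof -
    have "((\<lambda>w. of_real \<kappa> * w * h w) has_field_derivative of_real \<kappa>) (at 0)"
      using DERIV_mult[OF DERIV_cmult[OF DERIV_ident] h'[of 0], of "of_real \<kappa>"] r by (simp add: h0 mult_ac)
    from DERIV_mult[OF DERIV_add[OF h'' this] E'[of 0]] show ?thesis
      by (simp add: p'_def h'0)
  qed
  have p_holo: "p holomorphic_on ball 0 r"
    using p_deriv holomorphic_on_open by blast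
  have "(deriv ^^ 2) p 0 = deriv (deriv p) 0"
    by (simp add: eval_nat_numeral)
  also have "\<dots> = deriv p' 0"
  proof (rule deriv_cong_ev)
    have "\<forall>\<^sub>F w in nhds 0. w \<in> ball (0::complex) r"
      using r by (intro eventually_nhds_in_open) auto
    then show "\<forall>\<^sub>F w in nhds 0. deriv p w = p' w"
      by eventually_elim (use p_deriv DERIV_imp_deriv in blast)
  qed auto
  also have "\<dots> = 0"
    using p'_deriv by (rule DERIV_imp_deriv)
  finally have p2: "(deriv ^^ 2) p 0 = 0" .
  have p1: "deriv p 0 = 0"
    using DERIV_imp_deriv[OF p_deriv[of 0]] r by (simp add: p'_def h'0)
  have p0: "p 0 = 0"
    by (simp add: p_def E_def h0)
  have p_vanish: "(deriv ^^ k) p 0 = 0" if "k < 3" for k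
  proof -
    have "k = 0 \<or> k = 1 \<or> k = 2" using that by linarith
    then show ?thesis using p0 p1 p2 by auto
  qed
  have gp_vanish: "(deriv ^^ k) (\<lambda>w. g w * p w) 0 = 0" if "k < 3" for k
    using higher_deriv_mult[OF g p_holo, of 0 k] r that by (simp add: p_vanish)
  have E_real: "E (of_real t) = of_real (exp (\<kappa> / 2 * t^2))" for t
    unfolding E_def by (simp flip: of_real_mult of_real_power exp_of_real)
  have p_sym: "p (of_real (-t)) = cnj (p (of_real t))" if "\<bar>t\<bar> < r" for t
    using h_sym[OF that] by (simp add: p_def E_real[of t] E_real[of "-t", simplified])
  have s: "0 < r / 2" "r / 2 < r" using r by auto

  obtain C1 where C1: "C1 > 0"
    "\<And>t::real. \<bar>t\<bar> \<le> r/2 \<Longrightarrow> norm (g (of_real t) - g 0) \<le> C1 * \<bar>t\<bar> ^ 1"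
    "\<And>t::real. \<bar>t\<bar> \<le> r/2 \<Longrightarrow> \<bar>Re (g (of_real t)) - Re (g 0)\<bar> \<le> C1 * \<bar>t\<bar> ^ (1 + 1)"
    by (rule Re_even_Taylor_bound[OF g s g_sym, of 1]) auto
  obtain C2 where C2: "C2 > 0"
    "\<And>t::real. \<bar>t\<bar> \<le> r/2 \<Longrightarrow> norm (p (of_real t) - p 0) \<le> C2 * \<bar>t\<bar> ^ 3"
    by (rule Re_even_Taylor_bound[OF p_holo s p_sym, of 3]) (auto simp: p_vanish)
  obtain C3 where C3: "C3 > 0"
    "\<And>t::real. \<bar>t\<bar> \<le> r/2 \<Longrightarrow> \<bar>Re (g (of_real t) * p (of_real t)) - Re (g 0 * p 0)\<bar> \<le> C3 * \<bar>t\<bar> ^ (3 + 1)"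
  proof (rule Re_even_Taylor_bound[OF _ s, of "\<lambda>w. g w * p w" 3])
    show "(\<lambda>w. g w * p w) holomorphic_on ball 0 r"
      by (intro holomorphic_intros g p_holo)
  qed (auto simp: gp_vanish g_sym[simplified] p_sym[simplified])

  \<comment> \<open>For t \<le> \<delta> one has |p| \<le> C2 t^3 \<le> \<kappa> t^2 / 4, so exp(n
    |p|) uses up only half of the decay exp(-n \<kappa> t^2 / 2).\<close>
  define \<delta> where "\<delta> = min (r / 2) (\<kappa> / (4 * C2))"
  define M where "M = norm (g 0) + C1 * (r / 2)"
  define K where "K = C1 + C3 + M * C2^2"
  have M: "M \<ge> 0" unfolding M_def using C1 r by simp
  show ?thesis
  proof (rule that[of \<delta> K])
    show "0 < \<delta>" "\<delta> < r"
      using r \<kappa> C2 by (auto simp: \<delta>_def)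
    show "K > 0"
      unfolding K_def using C1(1) C3(1) M by (intro add_pos_nonneg) auto
  next
    fix t :: real and n :: nat
    assume t: "0 \<le> t" "t \<le> \<delta>"
    have tr: "\<bar>t\<bar> \<le> r / 2" using t by (simp add: \<delta>_def)
    define x where "x = real n * \<kappa> / 4 * t^2"
    have x: "x \<ge> 0" using \<kappa> by (simp add: x_def)
    define G P where "G = g (of_real t)" and "P = p (of_real t)"
    have P3: "norm P \<le> C2 * t ^ 3"
      using C2(2)[OF tr] t by (simp add: p0 P_def)
    have "C2 * t \<le> \<kappa> / 4"
      using t C2(1) by (simp add: \<delta>_def field_simps)
    then have "C2 * t * t^2 \<le> \<kappa> / 4 * t^2"
      by (intro mult_right_mono) auto
    then have "C2 * t ^ 3 \<le> \<kappa> / 4 * t^2"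
      by (simp add: power2_eq_square power3_eq_cube mult_ac)
    then have "real n * norm P \<le> real n * (\<kappa> / 4 * t^2)"
      using P3 by (intro mult_left_mono) auto
    then have nP: "real n * norm P \<le> x"
      by (simp add: x_def mult_ac)
    have GM: "norm G \<le> M"
    proof -
      have "norm G \<le> norm (g 0) + norm (G - g 0)"
        by (metis add_diff_cancel_left' diff_add_cancel norm_triangle_ineq)
      also have "norm (G - g 0) \<le> C1 * (r / 2)"
        using order.trans[OF C1(2)[OF tr, unfolded power_one_right] mult_left_mono[OF tr, of C1]] C1(1)
        by (simp add: G_def)
      finally show ?thesis by (simp add: M_def)
    qed
    define R where "R = (1 + P) ^ n - 1 - of_nat n * P"
    have "norm R \<le> (real n * norm P)^2 * exp (real n * norm P)"
      unfolding R_def by (rule power_one_plus_linear_approx)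
    also have "\<dots> \<le> (real n * (C2 * t^3))^2 * exp x"
      using P3 nP by (intro mult_mono power_mono mult_left_mono) auto
    also have "\<dots> = C2^2 * (real n ^ 2 * t ^ 6) * exp x"
      by (simp add: power_mult_distrib flip: power_mult)
    finally have R: "norm R \<le> C2^2 * (real n ^ 2 * t ^ 6) * exp x" .
    have "h (of_real t) = (1 + P) * of_real (exp (- (\<kappa> / 2 * t^2)))"
      by (simp add: P_def p_def E_real exp_minus field_simps flip: of_real_inverse)
    then have "h (of_real t) ^ n = (1 + P) ^ n * of_real (exp (- (\<kappa> / 2 * t^2)) ^ n)"
      by (simp only: power_mult_distrib of_real_power)
    also have "exp (- (\<kappa> / 2 * t^2)) ^ n = exp (- (2 * x))"
      by (simp add: x_def field_simps flip: exp_of_nat_mult)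
    also have "(1 + P) ^ n = 1 + of_nat n * P + R"
      by (simp add: R_def)
    finally have "G * h (of_real t) ^ n = of_real (exp (- (2 * x))) * (G + of_nat n * (G * P) + G * R)"
      by (simp add: algebra_simps)
    then have "Re (G * h (of_real t) ^ n) = exp (- (2 * x)) * (Re G + real n * Re (G * P) + Re (G * R))"
      by simp
    then have eq: "Re (G * h (of_real t) ^ n) - Re (g 0) * exp (- (2 * x)) =
      exp (- (2 * x)) * ((Re G - Re (g 0)) + real n * Re (G * P) + Re (G * R))"
      by (simp add: algebra_simps)
    have "\<bar>(Re G - Re (g 0)) + real n * Re (G * P) + Re (G * R)\<bar> \<le>
        \<bar>Re G - Re (g 0)\<bar> + real n * \<bar>Re (G * P)\<bar> + norm (G * R)"
    proof -
      have "\<bar>real n * Re (G * P)\<bar> = real n * \<bar>Re (G * P)\<bar>" by (simp only: abs_mult abs_of_nat)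
      then show ?thesis using abs_Re_le_cmod[of "G * R"] by linarith
    qed
    also have "\<dots> \<le> C1 * t^2 * exp x + real n * (C3 * t ^ 4) * exp x + M * (C2^2 * (real n ^ 2 * t ^ 6) * exp x)"
    proof (intro add_mono)
      have "\<bar>Re G - Re (g 0)\<bar> \<le> C1 * t^2 * 1"
        using C1(3)[OF tr] t by (simp add: G_def power2_eq_square)
      also have "\<dots> \<le> C1 * t^2 * exp x"
        using C1(1) x by (intro mult_left_mono) auto
      finally show "\<bar>Re G - Re (g 0)\<bar> \<le> C1 * t^2 * exp x" .
      have "\<bar>Re (G * P)\<bar> \<le> C3 * t ^ 4"
        using C3(2)[OF tr] t by (simp add: G_def P_def p0 eval_nat_numeral)
      then have "real n * \<bar>Re (G * P)\<bar> \<le> real n * (C3 * t ^ 4) * 1"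
        by (simp add: mult_left_mono)
      also have "\<dots> \<le> real n * (C3 * t ^ 4) * exp x"
        using C3(1) x t by (intro mult_left_mono) auto
      finally show "real n * \<bar>Re (G * P)\<bar> \<le> real n * (C3 * t ^ 4) * exp x" .
      show "norm (G * R) \<le> M * (C2^2 * (real n ^ 2 * t ^ 6) * exp x)"
        unfolding norm_mult using GM R M by (intro mult_mono) auto
    qed
    also have "\<dots> = exp x * (C1 * t^2 + C3 * (real n * t^4) + (M * C2^2) * (real n ^ 2 * t^6))"
      by (simp add: algebra_simps)
    also have "\<dots> \<le> exp x * (K * t^2 + K * (real n * t^4) + K * (real n ^ 2 * t^6))"
      using C1(1) C3(1) M t unfolding K_def by (intro mult_left_mono add_mono mult_right_mono) auto
    finally have "\<bar>(Re G - Re (g 0)) + real n * Re (G * P) + Re (G * R)\<bar> \<le>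
      exp x * (K * (t^2 + real n * t^4 + real n ^ 2 * t^6))"
      by (simp add: algebra_simps)
    then have "\<bar>Re (G * h (of_real t) ^ n) - Re (g 0) * exp (- (2 * x))\<bar> \<le>
      exp (- (2 * x)) * (exp x * (K * (t^2 + real n * t^4 + real n ^ 2 * t^6)))"
      unfolding eq abs_mult by (simp add: abs_mult)
    also have "\<dots> = (exp (- (2 * x)) * exp x) * (K * (t^2 + real n * t^4 + real n ^ 2 * t^6))"
      by (simp only: mult.assoc)
    also have "exp (- (2 * x)) * exp x = exp (- x)"
      by (simp flip: exp_add)
    also have "exp (- x) * (K * (t^2 + real n * t^4 + real n ^ 2 * t^6)) =
        K * (t^2 + real n * t^4 + real n ^ 2 * t^6) * exp (- x)"
      by (rule mult.commute)
    finally show "\<bar>Re (g (of_real t) * h (of_real t) ^ n) - Re (g 0) * exp (- (real n * \<kappa> / 2 * t^2))\<bar> \<le>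
       K * (t^2 + real n * t^4 + real n ^ 2 * t^6) * exp (- (real n * \<kappa> / 4 * t^2))"
      by (simp add: G_def x_def mult_ac)
  qed
qed

text \<open>The interval is split at a small \<delta>. Up to \<delta> the pointwise bound integrates
  to n^(-3/2), since each Gaussian integral brings n^(-1/2) and the bound itself 1/n; beyond
  \<delta> compactness keeps |h| below some \<mu> < 1, an exponentially small contribution.\<close>

theorem Laplace_symmetric:
  fixes g h h' :: "complex \<Rightarrow> complex" and \<kappa> b :: real
  assumes r: "r > 0" and \<kappa>: "\<kappa> > 0" and b: "b > 0"
    and g: "g holomorphic_on ball 0 r"
    and g_sym: "\<And>t::real. \<bar>t\<bar> < r \<Longrightarrow> g (of_real (-t)) = cnj (g (of_real t))"
    and h_sym: "\<And>t::real. \<bar>t\<bar> < r \<Longrightarrow> h (of_real (-t)) = cnj (h (of_real t))"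
    and h0: "h 0 = 1"
    and h': "\<And>w. w \<in> ball 0 r \<Longrightarrow> (h has_field_derivative h' w) (at w)" and h'0: "h' 0 = 0"
    and h'': "(h' has_field_derivative - of_real \<kappa>) (at 0)"
    and g_cont: "continuous_on {0..b} (\<lambda>t. g (of_real t))"
    and h_cont: "continuous_on {0..b} (\<lambda>t. h (of_real t))"
    and h_less: "\<And>t. 0 < t \<Longrightarrow> t \<le> b \<Longrightarrow> norm (h (of_real t)) < 1"
  shows "(\<lambda>n. integral {0..b} (\<lambda>t. Re (g (of_real t) * h (of_real t) ^ n)) -
           Re (g 0) * (sqrt (2 * pi / (\<kappa> * real n)) / 2)) \<in> O(\<lambda>n. real n powr (-3/2))"
proof -
  define f where "f = (\<lambda>n t. Re (g (of_real t) * h (of_real t) ^ n))"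
  obtain \<delta>0 K where \<delta>0: "0 < \<delta>0" "\<delta>0 < r" and K: "K > 0" and
    bound: "\<And>t n. 0 \<le> t \<Longrightarrow> t \<le> \<delta>0 \<Longrightarrow>
       \<bar>Re (g (of_real t) * h (of_real t) ^ n) - Re (g 0) * exp (- (real n * \<kappa> / 2 * t^2))\<bar> \<le>
       K * (t^2 + real n * t^4 + real n ^ 2 * t^6) * exp (- (real n * \<kappa> / 4 * t^2))"
    by (rule Laplace_pointwise_bound[OF r \<kappa> g g_sym h_sym h0 h' h'0 h'']) blast+
  define \<delta> where "\<delta> = min \<delta>0 b"
  have \<delta>: "0 < \<delta>" "\<delta> \<le> \<delta>0" "\<delta> \<le> b" using \<delta>0 b by (auto simp: \<delta>_def)
  \<comment> \<open>Turning x + x^2 + x^3 into an exponential at rate \<kappa>/8 halves the decay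
    rate \<kappa>/4 of the pointwise bound and leaves \<kappa>/8.\<close>
  define L where "L = 3 / (\<kappa> / 8) + (3 / (\<kappa> / 8))^2 + (3 / (\<kappa> / 8))^3"
  have L: "x + x^2 + x^3 \<le> L * exp (\<kappa> / 8 * x)" if "x \<ge> 0" for x
    unfolding L_def using \<kappa> that by (intro polynomial_le_exp) auto
  have "L > 0" unfolding L_def using \<kappa> by (intro add_pos_pos) auto
  define K2 where "K2 = max (K * L) (\<bar>Re (g 0)\<bar> * L / \<delta>^2)"
  \<comment> \<open>Extension by zero allows a comparison with the Gaussian on the whole half line,
    so the Gaussian tail beyond \<delta> is covered by the same bound; hence the second entry of the
    maximum in \<open>K2\<close>.\<close>
  define F where "F = (\<lambda>n t. if t \<in> {0..\<delta>} then f n t else 0)"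
  have f_cont: "continuous_on {0..b} (f n)" for n
    unfolding f_def by (intro continuous_intros g_cont h_cont)
  have f_int: "f n integrable_on {s..u}" if "{s..u} \<subseteq> {0..b}" for n s u
    using continuous_on_subset[OF f_cont that] by (rule integrable_continuous_interval)

  have bound2: "\<bar>F n t - Re (g 0) * exp (- (real n * \<kappa> / 2 * t^2))\<bar> \<le>
      K2 / n * exp (- (real n * \<kappa> / 8 * t^2))" if n: "n > 0" and t: "t \<ge> 0" for n t
  proof (cases "t \<le> \<delta>")
    case True
    define x where "x = real n * t^2"
    have x: "x \<ge> 0" by (simp add: x_def)
    have "\<bar>F n t - Re (g 0) * exp (- (real n * \<kappa> / 2 * t^2))\<bar> \<le>
        K * (t^2 + real n * t^4 + real n ^ 2 * t^6) * exp (- (real n * \<kappa> / 4 * t^2))"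
      using bound[of t n] True t \<delta> by (simp add: F_def f_def)
    also have "t^2 + real n * t^4 + real n ^ 2 * t^6 = (x + x^2 + x^3) / n"
      using n by (simp add: x_def field_simps power_mult_distrib eval_nat_numeral)
    also have "real n * \<kappa> / 4 * t^2 = \<kappa> / 4 * x"
      by (simp add: x_def)
    also have "K * ((x + x^2 + x^3) / n) * exp (- (\<kappa> / 4 * x)) \<le>
        K * ((L * exp (\<kappa> / 8 * x)) / n) * exp (- (\<kappa> / 4 * x))"
      using K L[OF x] by (intro mult_left_mono mult_right_mono divide_right_mono) auto
    also have "\<dots> = K * L / n * exp (- (\<kappa> / 8 * x))"
    proof -
      have "exp (\<kappa> / 8 * x) * exp (- (\<kappa> / 4 * x)) = exp (- (\<kappa> / 8 * x))"
        by (simp flip: exp_add)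
      then show ?thesis by simp
    qed
    also have "\<dots> \<le> K2 / n * exp (- (\<kappa> / 8 * x))"
      unfolding K2_def by (intro mult_right_mono divide_right_mono) auto
    finally show ?thesis by (simp add: x_def mult_ac)
  next
    case False
    define x where "x = real n * t^2"
    have x: "x \<ge> 0" by (simp add: x_def)
    have "\<delta>^2 \<le> t^2" using False \<delta> by (intro power_mono) auto
    then have "1 \<le> x / (real n * \<delta>^2)"
      using n \<delta> by (simp add: x_def)
    moreover have "x \<le> L * exp (\<kappa> / 8 * x)"
      using L[OF x] x by (smt (verit) zero_le_power)
    \<comment> \<open>The factor 1/n for the tail comes from n t^2 \<ge> n \<delta>^2, at the price
      of a little of the exponential decay.\<close>
    ultimately have one: "1 \<le> L * exp (\<kappa> / 8 * x) / (real n * \<delta>^2)"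
      using n \<delta> by (smt (verit) divide_right_mono mult_nonneg_nonneg of_nat_0_le_iff zero_le_power2)
    have "\<bar>F n t - Re (g 0) * exp (- (real n * \<kappa> / 2 * t^2))\<bar> = \<bar>Re (g 0)\<bar> * exp (- (\<kappa> / 2 * x)) * 1"
      using False by (simp add: F_def x_def abs_mult mult_ac)
    also have "\<dots> \<le> \<bar>Re (g 0)\<bar> * exp (- (\<kappa> / 2 * x)) * (L * exp (\<kappa> / 8 * x) / (real n * \<delta>^2))"
      by (intro mult_left_mono one) auto
    also have "\<dots> = \<bar>Re (g 0)\<bar> * L / \<delta>^2 / n * exp (- (3 * \<kappa> / 8 * x))"
    proof -
      have "exp (- (\<kappa> / 2 * x)) * exp (\<kappa> / 8 * x) = exp (- (3 * \<kappa> / 8 * x))"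
        by (simp flip: exp_add)
      then show ?thesis by (simp add: mult_ac)
    qed
    also have "\<dots> \<le> \<bar>Re (g 0)\<bar> * L / \<delta>^2 / n * exp (- (\<kappa> / 8 * x))"
      using \<open>L > 0\<close> \<kappa> x by (intro mult_left_mono) (auto simp: mult_right_mono)
    also have "\<dots> \<le> K2 / n * exp (- (\<kappa> / 8 * x))"
      unfolding K2_def by (intro mult_right_mono divide_right_mono) auto
    finally show ?thesis by (simp add: x_def mult_ac)
  qed

  have near: "\<bar>integral {0..\<delta>} (f n) - Re (g 0) * (sqrt (2 * pi / (\<kappa> * real n)) / 2)\<bar> \<le>
      K2 * sqrt (8 * pi / \<kappa>) / 2 * real n powr (-3/2)" if n: "n > 0" for n
  proof -
    have 1: "(F n has_integral integral {0..\<delta>} (f n)) {0..}"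
      unfolding F_def using f_int[of 0 \<delta> n] \<delta>
      by (subst has_integral_restrict) (auto intro: integrable_integral)
    have 2: "((\<lambda>t. exp (- (real n * \<kappa> / 2 * t^2))) has_integral (sqrt (2 * pi / (\<kappa> * real n)) / 2)) {0..}"
      using has_integral_gaussian_half_line[of "real n * \<kappa> / 2"] n \<kappa> by (simp add: mult_ac)
    have 3: "((\<lambda>t. exp (- (real n * \<kappa> / 8 * t^2))) has_integral (sqrt (8 * pi / (\<kappa> * real n)) / 2)) {0..}"
      using has_integral_gaussian_half_line[of "real n * \<kappa> / 8"] n \<kappa> by (simp add: mult_ac)
    note 4 = has_integral_diff[OF 1 has_integral_mult_right[OF 2, of "Re (g 0)"]]
    note 5 = has_integral_mult_right[OF 3, of "K2 / n"]
    have "\<bar>integral {0..\<delta>} (f n) - Re (g 0) * (sqrt (2 * pi / (\<kappa> * real n)) / 2)\<bar> \<le>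
        K2 / n * (sqrt (8 * pi / (\<kappa> * real n)) / 2)"
      using integral_norm_bound_integral[of _ "{0..}", OF has_integral_integrable[OF 4] has_integral_integrable[OF 5]]
        bound2[OF n] integral_unique[OF 4] integral_unique[OF 5] by simp
    also have "sqrt (8 * pi / (\<kappa> * real n)) = sqrt (8 * pi / \<kappa>) * real n powr (-1/2)"
      using n by (simp add: real_sqrt_divide real_sqrt_mult powr_minus powr_half_sqrt field_simps)
    also have "K2 / n * (sqrt (8 * pi / \<kappa>) * real n powr (-1/2) / 2) =
        K2 * sqrt (8 * pi / \<kappa>) / 2 * (real n powr (-1/2) * real n powr (-1))"
      using n by (simp add: powr_minus field_simps)
    also have "real n powr (-1/2) * real n powr (-1) = real n powr (-3/2)"
      using powr_add[of "real n" "-1/2" "-1"] by simp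
    finally show ?thesis .
  qed

  have "compact ((\<lambda>t. norm (h (of_real t))) ` {\<delta>..b})" "(\<lambda>t. norm (h (of_real t))) ` {\<delta>..b} \<noteq> {}"
    using \<delta> by (auto intro!: compact_continuous_image continuous_intros continuous_on_subset[OF h_cont])
  from compact_attains_sup[OF this]
  obtain t0 where t0: "t0 \<in> {\<delta>..b}" "\<And>t. t \<in> {\<delta>..b} \<Longrightarrow> norm (h (of_real t)) \<le> norm (h (of_real t0))"
    by blast
  \<comment> \<open>The 1/2 keeps \<mu> positive even if h vanishes on the far part.\<close>
  define \<mu> where "\<mu> = max (1/2) (norm (h (of_real t0)))"
  have \<mu>: "0 < \<mu>" "\<mu> < 1" "\<And>t. t \<in> {\<delta>..b} \<Longrightarrow> norm (h (of_real t)) \<le> \<mu>"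
    using t0 h_less[of t0] \<delta> by (fastforce simp: \<mu>_def)+
  have "bounded ((\<lambda>t. g (of_real t)) ` {0..b})"
    by (intro compact_imp_bounded compact_continuous_image g_cont) auto
  then obtain M where M: "M > 0" "\<And>t. t \<in> {0..b} \<Longrightarrow> norm (g (of_real t)) \<le> M"
    unfolding bounded_pos by blast
  have far: "\<bar>integral {\<delta>..b} (f n)\<bar> \<le> M * b * \<mu> ^ n" for n
  proof -
    have "norm (integral {\<delta>..b} (f n)) \<le> M * \<mu> ^ n * (b - \<delta>)"
    proof (rule integral_bound)
      show "continuous_on {\<delta>..b} (f n)"
        using \<delta> by (intro continuous_on_subset[OF f_cont]) auto
      fix t assume t: "t \<in> {\<delta>..b}"
      have "norm (f n t) \<le> norm (g (of_real t) * h (of_real t) ^ n)"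
        unfolding f_def real_norm_def by (rule abs_Re_le_cmod)
      also have "\<dots> \<le> M * \<mu> ^ n"
        unfolding norm_mult norm_power using M \<mu> t \<delta> by (intro mult_mono power_mono) auto
      finally show "norm (f n t) \<le> M * \<mu> ^ n" .
    qed (use \<delta> in auto)
    also have "\<dots> \<le> M * \<mu> ^ n * b"
      using M \<mu> \<delta> by (intro mult_left_mono) auto
    finally show ?thesis by (simp add: mult_ac)
  qed

  have "(\<lambda>n. integral {0..b} (f n) - Re (g 0) * (sqrt (2 * pi / (\<kappa> * real n)) / 2)) \<in>
      O(\<lambda>n. K2 * sqrt (8 * pi / \<kappa>) / 2 * real n powr (-3/2) + M * b * \<mu> ^ n)"
  proof (rule bigoI[of _ 1], rule eventually_mono[OF eventually_gt_at_top[of 0]])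
    fix n :: nat assume n: "n > 0"
    have "integral {0..b} (f n) = integral {0..\<delta>} (f n) + integral {\<delta>..b} (f n)"
      using \<delta> f_int[of 0 b n] by (intro Henstock_Kurzweil_Integration.integral_combine[symmetric]) auto
    then have "\<bar>integral {0..b} (f n) - Re (g 0) * (sqrt (2 * pi / (\<kappa> * real n)) / 2)\<bar> \<le>
        K2 * sqrt (8 * pi / \<kappa>) / 2 * real n powr (-3/2) + M * b * \<mu> ^ n"
      using near[OF n] far[of n] by linarith
    then show "norm (integral {0..b} (f n) - Re (g 0) * (sqrt (2 * pi / (\<kappa> * real n)) / 2)) \<le>
        1 * norm (K2 * sqrt (8 * pi / \<kappa>) / 2 * real n powr (-3/2) + M * b * \<mu> ^ n)"
      by simp
  qed
  also have "(\<lambda>n. K2 * sqrt (8 * pi / \<kappa>) / 2 * real n powr (-3/2) + M * b * \<mu> ^ n) \<in> O(\<lambda>n. real n powr (-3/2))"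
  proof (rule sum_in_bigo)
    have "(\<lambda>n. \<mu> ^ n) \<in> O(\<lambda>n. real n powr (-3/2))"
      using \<mu>(1,2) by real_asymp
    then show "(\<lambda>n. M * b * \<mu> ^ n) \<in> O(\<lambda>n. real n powr (-3/2))"
      by simp
  qed simp
  finally show ?thesis unfolding f_def .
qed

section \<open>Lagrange inversion and Taylor coefficients\<close>

text \<open>With \<Phi> = X / Z, the right-hand side is the residue of (W o Z)' / Z^n, stated
  without negative powers. The chain rule turns it into a combination of residues of Z' / Z^m, and
  only m = 1 survives.\<close>

theorem fps_Lagrange_inversion:
  fixes Z \<Phi> W :: "'a :: field_char_0 fps"
  assumes Z: "Z * \<Phi> = fps_X" and \<Phi>0: "fps_nth \<Phi> 0 \<noteq> 0" and n: "n > 0"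
  shows "of_nat n * fps_nth W n = fps_nth (fps_deriv (W oo Z) * \<Phi> ^ n) (n - 1)"
proof -
  have Z0: "fps_nth Z 0 = 0"
    using arg_cong[OF Z, of "\<lambda>F. fps_nth F 0"] \<Phi>0 by simp
  have dZ: "fps_deriv Z * \<Phi> = 1 - Z * fps_deriv \<Phi>"
    using arg_cong[OF Z, of fps_deriv] by (simp add: algebra_simps)
  \<comment> \<open>For m \<noteq> 1, Z' / Z^m is a derivative and so has residue 0. In terms of
    \<Phi> the two contributions agree after multiplication by k = m - 1, which is cancelled in
    characteristic 0.\<close>
  have coeff: "fps_nth (\<Phi> ^ m * fps_deriv Z) (m - 1) = (if m = 1 then 1 else 0)" if "m > 0" for m
  proof -
    obtain k where k: "m = Suc k" using \<open>m > 0\<close> by (cases m) auto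
    have eq: "\<Phi> ^ m * fps_deriv Z = \<Phi> ^ k * (1 - Z * fps_deriv \<Phi>)"
      unfolding dZ[symmetric] k by (simp add: mult_ac)
    show ?thesis
    proof (cases k)
      case 0
      then show ?thesis using k eq Z0 by simp
    next
      case (Suc l)
      have "\<Phi> ^ k * (1 - Z * fps_deriv \<Phi>) = \<Phi> ^ k - (Z * \<Phi>) * (\<Phi> ^ l * fps_deriv \<Phi>)"
        by (simp add: Suc algebra_simps)
      also have "fps_nth \<dots> k = fps_nth (\<Phi> ^ k) k - fps_nth (\<Phi> ^ l * fps_deriv \<Phi>) l"
        unfolding Z by (simp add: Suc)
      also have "\<dots> = 0"
      proof -
        have "fps_deriv (\<Phi> ^ k) = fps_const (of_nat k) * (\<Phi> ^ l * fps_deriv \<Phi>)"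
          unfolding fps_deriv_power by (simp add: Suc mult_ac)
        moreover have "fps_nth (fps_deriv (\<Phi> ^ k)) l = of_nat k * fps_nth (\<Phi> ^ k) k"
          by (simp only: fps_deriv_nth Suc Suc_eq_plus1)
        ultimately have "of_nat k * fps_nth (\<Phi> ^ k) k = of_nat k * fps_nth (\<Phi> ^ l * fps_deriv \<Phi>) l"
          by (simp only: fps_mult_left_const_nth)
        then show ?thesis using Suc by (simp del: of_nat_Suc)
      qed
      finally show ?thesis unfolding eq using k Suc by simp
    qed
  qed
  define V where "V = fps_deriv W"
  define T where "T = (\<Sum>i<n. fps_const (fps_nth V i) * fps_X ^ i)"
  define B where "B = fps_deriv Z * \<Phi> ^ n"
  \<comment> \<open>The tail of W' contributes a multiple of Z^n \<Phi>^n = X^n, which does not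
    reach the coefficient of index n - 1.\<close>
  have V_eq: "V = T + fps_X ^ n * fps_shift n V"
  proof (rule fps_ext)
    fix j
    have "fps_nth T j = (if j < n then fps_nth V j else 0)"
      unfolding T_def fps_sum_nth by (simp add: if_distrib cong: if_cong)
    then show "fps_nth V j = fps_nth (T + fps_X ^ n * fps_shift n V) j"
      by (simp add: fps_X_power_mult_nth)
  qed
  have "V oo Z = (T oo Z) + Z ^ n * (fps_shift n V oo Z)"
    by (subst V_eq) (simp add: fps_compose_add_distrib fps_compose_mult_distrib Z0 flip: fps_compose_power)
  also have "T oo Z = (\<Sum>i<n. fps_const (fps_nth V i) * Z ^ i)"
    unfolding T_def by (simp add: fps_compose_sum_distrib fps_compose_mult_distrib Z0 flip: fps_compose_power)
  finally have "fps_deriv (W oo Z) * \<Phi> ^ n =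
      (\<Sum>i<n. fps_const (fps_nth V i) * (Z ^ i * B)) + (Z * \<Phi>) ^ n * ((fps_shift n V oo Z) * fps_deriv Z)"
    unfolding fps_compose_deriv[OF Z0] V_def[symmetric] B_def
    by (simp add: algebra_simps sum_distrib_left sum_distrib_right power_mult_distrib)
  then have "fps_nth (fps_deriv (W oo Z) * \<Phi> ^ n) (n - 1) =
      (\<Sum>i<n. fps_nth V i * fps_nth (Z ^ i * B) (n - 1))"
    using n unfolding Z by (simp add: fps_sum_nth fps_X_power_mult_nth)
  also have "\<dots> = (\<Sum>i<n. fps_nth V i * (if i = n - 1 then 1 else 0))"
  proof (rule sum.cong)
    fix i assume "i \<in> {..<n}"
    then have i: "i < n" by simp
    have "Z ^ i * B = (Z * \<Phi>) ^ i * (\<Phi> ^ (n - i) * fps_deriv Z)"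
      using i unfolding B_def by (simp add: power_mult_distrib mult_ac flip: power_add)
    then have "fps_nth (Z ^ i * B) (n - 1) = fps_nth (\<Phi> ^ (n - i) * fps_deriv Z) ((n - i) - 1)"
      using i unfolding Z by (simp add: fps_X_power_mult_nth)
    also have "\<dots> = (if n - i = 1 then 1 else 0)"
      using i by (intro coeff) auto
    also have "\<dots> = (if i = n - 1 then 1 else 0)" using i by auto
    finally show "fps_nth V i * fps_nth (Z ^ i * B) (n - 1) = fps_nth V i * (if i = n - 1 then 1 else 0)"
      by simp
  qed simp
  also have "\<dots> = fps_nth V (n - 1)"
    using n by (simp add: if_distrib cong: if_cong)
  also have "\<dots> = of_nat n * fps_nth W n"
    using n by (simp add: V_def)
  finally show ?thesis by simp
qed

text \<open>Cauchy's formula on the full circle, folded along the real axis by conjugation symmetry.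
  This moves the peak at t = 0 to the end point of the interval, the setting of the Laplace
  estimate.\<close>

lemma Re_Taylor_coeff_eq_half_circle_integral:
  fixes f :: "complex \<Rightarrow> complex"
  assumes holo: "f holomorphic_on ball 0 R" and r: "0 < r" "r < R"
    and sym: "\<And>y. norm y = r \<Longrightarrow> f (cnj y) = cnj (f y)"
  shows "Re ((deriv ^^ k) f 0 / fact k) =
    integral {0..pi} (\<lambda>t. Re (f (of_real r * cis t) / (of_real r * cis t) ^ k)) / pi"
proof -
  define c where "c = (deriv ^^ k) f 0 / fact k"
  define F where "F = (\<lambda>t. f (of_real r * cis t) / (of_real r * cis t) ^ k)"
  have cont: "continuous_on (cball 0 r) f"
    using r by (intro holomorphic_on_imp_continuous_on holomorphic_on_subset[OF holo]) auto
  have "((\<lambda>u. f u / (u - 0) ^ (Suc k)) has_contour_integral ((2 * pi * \<i>) / (fact k) * (deriv ^^ k) f 0)) (circlepath 0 r)"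
    using r by (intro Cauchy_has_contour_integral_higher_derivative_circlepath cont
      holomorphic_on_subset[OF holo]) auto
  then have "((\<lambda>t. f (of_real r * cis t) / (of_real r * cis t) ^ Suc k * of_real r * \<i> * cis t) has_integral
      (2 * pi * \<i>) / (fact k) * (deriv ^^ k) f 0) {0..2*pi}"
    unfolding circlepath_def by (subst (asm) has_contour_integral_part_circlepath_iff) auto
  from has_integral_mult_right[OF this, of "- \<i>"]
  have "(F has_integral 2 * pi * c) {0..2*pi}"
    using r by (simp add: F_def c_def field_simps)
  then have *: "((\<lambda>t. Re (F t)) has_integral 2 * pi * Re c) {0..2*pi}"
    by (auto dest: has_integral_Re)
  have F_cont: "continuous_on A (\<lambda>t. Re (F t))" for A
  proof -
    have "continuous_on A (\<lambda>t. f (of_real r * cis t))"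
      using r by (intro continuous_on_compose2[OF cont] continuous_intros) (auto simp: norm_mult)
    then show ?thesis unfolding F_def using r by (intro continuous_intros) auto
  qed
  then have int: "(\<lambda>t. Re (F t)) integrable_on {a..b}" for a b
    by (intro integrable_continuous_interval)
  have F_sym: "Re (F (2 * pi - t)) = Re (F t)" for t
  proof -
    have "cis (2 * pi - t) = cnj (cis t)"
      by (simp add: complex_eq_iff cos_diff sin_diff)
    then have "F (2 * pi - t) = cnj (F t)"
      using sym[of "of_real r * cis t"] r by (simp add: F_def norm_mult)
    then show ?thesis by simp
  qed
  have "integral {pi..2*pi} (\<lambda>t. Re (F t)) = integral {0..pi} (\<lambda>t. Re (F t))"
  proof -
    have "((\<lambda>t. Re (F (- 1 * t + 2 * pi))) has_integral integral {pi..2*pi} (\<lambda>t. Re (F t))) {0..pi}"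
      using has_integral_affinity[OF integrable_integral[OF int, of pi "2*pi", folded box_real], of "-1" "2*pi"]
      by (simp add: image_affinity_cbox)
    then show ?thesis using F_sym by (auto simp: integral_unique add.commute)
  qed
  moreover have "integral {0..2*pi} (\<lambda>t. Re (F t)) =
      integral {0..pi} (\<lambda>t. Re (F t)) + integral {pi..2*pi} (\<lambda>t. Re (F t))"
    using int by (intro Henstock_Kurzweil_Integration.integral_combine[symmetric]) auto
  moreover have "integral {0..2*pi} (\<lambda>t. Re (F t)) = 2 * pi * Re c"
    using * by (rule integral_unique)
  ultimately have "Re c = integral {0..pi} (\<lambda>t. Re (F t)) / pi" by (simp add: field_simps)
  then show ?thesis unfolding c_def F_def .
qed

section \<open>Power series with square-root singularities\<close>

text \<open>The terms at \<rho> are of order n^(-3/2), hence summable, while those of the derived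
  series are eventually at least a multiple of n^(-1/2) and so diverge. Divergence bounds the radius
  from above and, the terms being eventually nonnegative, forces f' to infinity; the mean value
  theorem transfers this to the difference quotient.\<close>

lemma square_root_singularity_consequences:
  fixes f :: "real fps" and \<rho> c :: real
  assumes \<rho>: "\<rho> > 0" and c: "c > 0"
    and lim: "(\<lambda>n. fps_nth f n * \<rho> ^ n * real n powr (3/2)) \<longlonglongrightarrow> c"
  shows summable_norm_at_singularity: "summable (\<lambda>n. norm (fps_nth f n * \<rho> ^ n))"
    and conv_radius_at_singularity: "fps_conv_radius f = ereal \<rho>"
    and continuous_to_singularity: "continuous_on {0..\<rho>} (eval_fps f)"
    and infinite_deriv_at_singularity: "infinite_deriv_at_left (eval_fps f) \<rho>"
proof -
  show sm: "summable (\<lambda>n. norm (fps_nth f n * \<rho> ^ n))"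
  proof (rule summable_comparison_test_bigo)
    show "summable (\<lambda>n. norm (real n powr (-3/2)))"
      by (simp add: summable_real_powr_iff)
    have "(\<lambda>n. fps_nth f n * \<rho> ^ n * real n powr (3/2)) \<in> O(\<lambda>n. 1)"
      using lim c by (intro bigoI_tendsto[where c = c]) auto
    then have "(\<lambda>n. fps_nth f n * \<rho> ^ n * real n powr (3/2) * real n powr (-3/2)) \<in> O(\<lambda>n. 1 * real n powr (-3/2))"
      by (intro landau_o.big.mult) auto
    also have "?this \<longleftrightarrow> (\<lambda>n. fps_nth f n * \<rho> ^ n) \<in> O(\<lambda>n. real n powr (-3/2))"
      by (intro landau_o.big.cong_ex eventually_mono[OF eventually_gt_at_top[of 0]])
         (auto simp: mult.assoc simp flip: powr_add)
    finally show "(\<lambda>n. norm (fps_nth f n * \<rho> ^ n)) \<in> O(\<lambda>n. real n powr (-3/2))"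
      by simp
  qed
  have ge: "fps_conv_radius f \<ge> ereal \<rho>"
    unfolding fps_conv_radius_def
    using conv_radius_geI[of "fps_nth f" \<rho>] summable_norm_cancel[OF sm] \<rho> by simp

  define d where "d = (\<lambda>n. fps_nth (fps_deriv f) n)"
  have "eventually (\<lambda>n. fps_nth f n * \<rho> ^ n * real n powr (3/2) > c / 2) sequentially"
    using lim c by (intro order_tendstoD(1)) auto
  then obtain N0 where N0: "\<And>n. n \<ge> N0 \<Longrightarrow> fps_nth f n * \<rho> ^ n * real n powr (3/2) > c / 2"
    by (auto simp: eventually_at_top_linorder)
  have d_ge: "d n * \<rho> ^ n \<ge> c / (2 * \<rho>) * real (Suc n) powr (-1/2)" if "n \<ge> N0" for n
  proof -
    have "real (Suc n) powr (3/2) * real (Suc n) powr (-1/2) = real (Suc n)"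
      by (simp flip: powr_add)
    then have "d n * \<rho> ^ n =
        (fps_nth f (Suc n) * \<rho> ^ Suc n * real (Suc n) powr (3/2)) * (real (Suc n) powr (-1/2) / \<rho>)"
      using \<rho> by (simp add: d_def field_simps)
    also have "\<dots> \<ge> (c / 2) * (real (Suc n) powr (-1/2) / \<rho>)"
      using N0[of "Suc n"] that \<rho> by (intro mult_right_mono) auto
    finally show ?thesis by (simp add: mult_ac)
  qed
  then have d_nonneg: "d n \<ge> 0" if "n \<ge> N0" for n
  proof -
    have "0 \<le> c / (2 * \<rho>) * real (Suc n) powr (-1/2)" using c \<rho> by simp
    also have "\<dots> \<le> d n * \<rho> ^ n" by (rule d_ge[OF that])
    finally show ?thesis
      using zero_less_power[OF \<rho>, of n] zero_le_mult_iff[of "d n" "\<rho> ^ n"] by linarith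
  qed
  have not_summable: "\<not> summable (\<lambda>n. d n * \<rho> ^ n)"
  proof
    assume "summable (\<lambda>n. d n * \<rho> ^ n)"
    moreover have "\<exists>N. \<forall>n\<ge>N. norm (c / (2 * \<rho>) * real (Suc n) powr (-1/2)) \<le> d n * \<rho> ^ n"
      using d_ge c \<rho> by (intro exI[of _ N0]) auto
    ultimately have "summable (\<lambda>n. c / (2 * \<rho>) * real (Suc n) powr (-1/2))"
      by (rule summable_comparison_test[rotated])
    then have "summable (\<lambda>n. real (Suc n) powr (-1/2))"
      using c \<rho> by (simp add: summable_cmult_iff)
    then show False
      by (subst (asm) summable_Suc_iff) (simp add: summable_real_powr_iff)
  qed
  show radius: "fps_conv_radius f = ereal \<rho>"
  proof (rule antisym[OF _ ge], rule ccontr)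
    assume "\<not> fps_conv_radius f \<le> ereal \<rho>"
    then have "ereal (norm \<rho>) < fps_conv_radius (fps_deriv f)"
      using \<rho> less_le_trans[OF _ fps_conv_radius_deriv[of f]] by simp
    from summable_fps[OF this] not_summable show False by (simp add: d_def)
  qed

  show cont: "continuous_on {0..\<rho>} (eval_fps f)"
  proof -
    have "uniform_limit {0..\<rho>} (\<lambda>n x. \<Sum>i<n. fps_nth f i * x ^ i) (\<lambda>x. \<Sum>i. fps_nth f i * x ^ i) sequentially"
      using \<rho> by (intro Weierstrass_m_test[OF _ sm])
         (auto simp: abs_mult norm_power intro!: mult_left_mono power_mono)
    then have "continuous_on {0..\<rho>} (\<lambda>x. \<Sum>i. fps_nth f i * x ^ i)"
      by (rule uniform_limit_theorem[rotated]) (auto intro!: always_eventually continuous_intros)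
    then show ?thesis by (simp add: eval_fps_def[abs_def])
  qed

  have deriv_large: "eventually (\<lambda>x. eval_fps (fps_deriv f) x > B) (at_left \<rho>)" for B
  proof -
    \<comment> \<open>Cutting at M \<ge> N0 leaves only nonnegative terms beyond M, so the finite
      sum, which is continuous at \<rho>, bounds f' from below.\<close>
    have "\<exists>M\<ge>N0. (\<Sum>n<M. d n * \<rho> ^ n) > B"
    proof (rule ccontr)
      assume "\<not> (\<exists>M\<ge>N0. (\<Sum>n<M. d n * \<rho> ^ n) > B)"
      then have le: "(\<Sum>n<M. d n * \<rho> ^ n) \<le> B" if "M \<ge> N0" for M
        using that by (auto simp: not_less)
      have "summable (\<lambda>n. d (n + N0) * \<rho> ^ (n + N0))"
      proof (rule summableI_nonneg_bounded)
        fix n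
        show "0 \<le> d (n + N0) * \<rho> ^ (n + N0)" using d_nonneg[of "n + N0"] \<rho> by simp
        have "(\<Sum>i<n. d (i + N0) * \<rho> ^ (i + N0)) = (\<Sum>i<n + N0. d i * \<rho> ^ i) - (\<Sum>i<N0. d i * \<rho> ^ i)"
          by (induction n) auto
        also have "\<dots> \<le> B - (\<Sum>i<N0. d i * \<rho> ^ i)" using le[of "n + N0"] by simp
        finally show "(\<Sum>i<n. d (i + N0) * \<rho> ^ (i + N0)) \<le> B - (\<Sum>i<N0. d i * \<rho> ^ i)" .
      qed
      then show False using not_summable summable_iff_shift[of "\<lambda>n. d n * \<rho> ^ n" N0] by blast
    qed
    then obtain M where M: "M \<ge> N0" "(\<Sum>n<M. d n * \<rho> ^ n) > B" by blast
    have "((\<lambda>x. \<Sum>n<M. d n * x ^ n) \<longlongrightarrow> (\<Sum>n<M. d n * \<rho> ^ n)) (at_left \<rho>)"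
      by (intro tendsto_intros)
    from order_tendstoD(1)[OF this M(2)]
    have "eventually (\<lambda>x. (\<Sum>n<M. d n * x ^ n) > B) (at_left \<rho>)" .
    moreover have "eventually (\<lambda>x. x \<in> {0<..<\<rho>}) (at_left \<rho>)"
      using eventually_at_left_real[OF \<rho>] .
    ultimately show ?thesis
    proof eventually_elim
      case (elim x)
      have "ereal (norm x) < fps_conv_radius f" using elim by (simp add: radius)
      then have "ereal (norm x) < fps_conv_radius (fps_deriv f)"
        using fps_conv_radius_deriv[of f] by (rule less_le_trans)
      from summable_fps[OF this] have "(\<Sum>n<M. d n * x ^ n) \<le> (\<Sum>n. d n * x ^ n)"
        unfolding d_def[symmetric] using elim M d_nonneg
        by (intro sum_le_suminf) auto
      then show ?case using elim by (simp add: eval_fps_def d_def)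
    qed
  qed
  have deriv_eq: "(eval_fps f has_field_derivative eval_fps (fps_deriv f) x) (at x)" if "0 < x" "x < \<rho>" for x
    using that by (intro has_field_derivative_eval_fps) (simp add: radius)
  then have differentiable: "eval_fps f differentiable (at x)" if "0 < x" "x < \<rho>" for x
    using that unfolding real_differentiable_def by blast
  show "infinite_deriv_at_left (eval_fps f) \<rho>"
    unfolding infinite_deriv_at_left_def filterlim_at_top_dense
  proof (intro conjI allI)
    fix B
    show "eventually (\<lambda>x. deriv (eval_fps f) x > B) (at_left \<rho>)"
      using deriv_large[of B] eventually_at_left_real[OF \<rho>]
      by eventually_elim (use deriv_eq DERIV_imp_deriv in fastforce)
    obtain b where b: "b < \<rho>" "\<And>x. b < x \<Longrightarrow> x < \<rho> \<Longrightarrow> eval_fps (fps_deriv f) x > B"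
      using deriv_large[of B] by (auto simp: eventually_at_left_field)
    show "eventually (\<lambda>x. (eval_fps f x - eval_fps f \<rho>) / (x - \<rho>) > B) (at_left \<rho>)"
      using eventually_at_left_real[of "max 0 b" \<rho>, simplified, OF conjI[OF \<rho> b(1)]]
    proof eventually_elim
      case (elim x)
      have "\<exists>l z. x < z \<and> z < \<rho> \<and> (eval_fps f has_real_derivative l) (at z) \<and>
          eval_fps f \<rho> - eval_fps f x = (\<rho> - x) * l"
        using elim differentiable by (intro MVT continuous_on_subset[OF cont]) auto
      then obtain l z where z: "x < z" "z < \<rho>" "(eval_fps f has_real_derivative l) (at z)"
        "eval_fps f \<rho> - eval_fps f x = (\<rho> - x) * l" by blast
      have "l = eval_fps (fps_deriv f) z"
        using z deriv_eq[of z] elim by (intro DERIV_unique[OF z(3)]) auto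
      then have "l > B" using b(2)[of z] z elim by simp
      moreover have "(eval_fps f x - eval_fps f \<rho>) / (x - \<rho>) = l"
        using z(4) elim by (simp add: field_simps)
      ultimately show ?case by simp
    qed
  qed
qed

text \<open>Here w belongs to z P or z (Q - 1) and Lagrange inversion controls n w(n). Undoing the
  factor z moves the index by one, which accounts for the 1/\<rho> in \<gamma>; the agreement is
  only eventual because Q and Q - 1 differ in the constant term.\<close>

lemma shifted_coeff_asymptotics:
  fixes a w :: "nat \<Rightarrow> real"
  assumes C: "C > 0" and \<rho>: "\<rho> > 0" and \<gamma>: "\<gamma> = C * sqrt pi / \<rho>"
    and err: "(\<lambda>n. real n * w n * \<rho> ^ n - C * real n powr (-1/2)) \<in> O(\<lambda>n. real n powr (-3/2))"
    and aw: "eventually (\<lambda>n. a n = w (Suc n)) sequentially"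
  shows "\<exists>e \<in> O(\<lambda>n. 1 / real n). \<forall>\<^sub>F n in sequentially.
           a n = \<gamma> * \<rho> powi (- int n) / (sqrt pi * real n powr (3/2)) * (1 + e n)"
    and "(\<lambda>n. a n * \<rho> ^ n * real n powr (3/2)) \<longlonglongrightarrow> C / \<rho>"
proof -
  define e where "e = (\<lambda>n. a n * \<rho> ^ n * real n powr (3/2) * \<rho> / C - 1)"
  define d where "d = (\<lambda>n. real (Suc n) * w (Suc n) * \<rho> ^ Suc n - C * real (Suc n) powr (-1/2))"
  have d: "d \<in> O(\<lambda>n. real (Suc n) powr (-3/2))"
    unfolding d_def by (rule landau_o.big.compose[OF err filterlim_Suc])
  \<comment> \<open>The first summand is the effect of the index shift on the main term, the second
    the transported error.\<close>
  have "(\<lambda>n. (real n powr (3/2) * real (Suc n) powr (-3/2) - 1) + (1 / C * real n powr (3/2) / real (Suc n)) * d n)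
      \<in> O(\<lambda>n. 1 / real n)"
  proof (rule sum_in_bigo)
    show "(\<lambda>n. real n powr (3/2) * real (Suc n) powr (-3/2) - 1) \<in> O(\<lambda>n. 1 / real n)"
      by real_asymp
    have "(\<lambda>n. (1 / C * real n powr (3/2) / real (Suc n)) * d n) \<in>
        O(\<lambda>n. (1 / C * real n powr (3/2) / real (Suc n)) * real (Suc n) powr (-3/2))"
      by (intro landau_o.big.mult_left d)
    also have "(\<lambda>n. (1 / C * real n powr (3/2) / real (Suc n)) * real (Suc n) powr (-3/2)) \<in> O(\<lambda>n. 1 / real n)"
      using C by real_asymp
    finally show "(\<lambda>n. (1 / C * real n powr (3/2) / real (Suc n)) * d n) \<in> O(\<lambda>n. 1 / real n)" .
  qed
  also have "?this \<longleftrightarrow> e \<in> O(\<lambda>n. 1 / real n)"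
  proof (rule landau_o.big.in_cong)
    show "\<forall>\<^sub>F n in sequentially. real n powr (3/2) * real (Suc n) powr (-3/2) - 1 +
        (1 / C * real n powr (3/2) / real (Suc n)) * d n = e n"
      using aw
    proof eventually_elim
      case (elim n)
      define s where "s = real (Suc n)"
      have s: "s > 0" by (simp add: s_def)
      have "s powr (-3/2) = s powr (-1/2) / s"
        using powr_add[of s "-1/2" "-1"] powr_neg_one[OF s] by simp
      moreover have an: "a n * \<rho> ^ n * \<rho> = (C * s powr (-1/2) + d n) / s"
        using s unfolding d_def elim s_def by (simp add: field_simps)
      have "e n = real n powr (3/2) * ((C * s powr (-1/2) + d n) / s) / C - 1"
        unfolding an[symmetric] by (simp add: e_def mult_ac)
      ultimately show ?case
        using C s unfolding s_def[symmetric] by (simp add: field_simps)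
    qed
  qed
  finally have e: "e \<in> O(\<lambda>n. 1 / real n)" .
  have eq: "a n = \<gamma> * \<rho> powi (- int n) / (sqrt pi * real n powr (3/2)) * (1 + e n)" if "n > 0" for n
    using that C \<rho> unfolding e_def \<gamma> by (simp add: power_int_minus field_simps)
  show "\<exists>e \<in> O(\<lambda>n. 1 / real n). \<forall>\<^sub>F n in sequentially.
           a n = \<gamma> * \<rho> powi (- int n) / (sqrt pi * real n powr (3/2)) * (1 + e n)"
    using e by (intro bexI[of _ e] eventually_mono[OF eventually_gt_at_top[of 0]] eq)
  have "(\<lambda>n. 1 / real n) \<in> o(\<lambda>_. 1)" by real_asymp
  with e have "e \<in> o(\<lambda>_. 1)" by (rule landau_o.big_small_trans)
  from smalloD_tendsto[OF this] have "e \<longlonglongrightarrow> 0" by simp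
  then have "(\<lambda>n. C / \<rho> * (1 + e n)) \<longlonglongrightarrow> C / \<rho> * (1 + 0)"
    by (intro tendsto_intros)
  moreover have "C / \<rho> * (1 + e n) = a n * \<rho> ^ n * real n powr (3/2)" for n
    using C \<rho> by (simp add: e_def)
  ultimately show "(\<lambda>n. a n * \<rho> ^ n * real n powr (3/2)) \<longlonglongrightarrow> C / \<rho>" by simp
qed

section \<open>The critical point of the curve\<close>

text \<open>The candidate \<nu> / (2 - \<nu>^3) comes from eliminating the square of z between F = 0
  and F_y = 0. It is a root of the polynomial defining \<rho> and lies in (0,1), where that
  polynomial decreases, so no smaller positive root exists.\<close>

lemma rho_nu_bounds: "0 < nu" "nu < 1/2" "rho = nu / (2 - nu^3)" "0 < rho" "rho < nu"
proof -
  show nu: "0 < nu" by (rule nu_least)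
  have "\<exists>y\<ge>0. y \<le> 1/2 \<and> y^7 - 2*y^6 - 4*y^4 + 4*y^3 + 4*y - 2 = (0::real)"
    by (rule IVT') (auto simp: eval_nat_numeral intro!: continuous_intros)
  then obtain y :: real where y: "y \<ge> 0" "y \<le> 1/2" "y^7 - 2*y^6 - 4*y^4 + 4*y^3 + 4*y - 2 = 0"
    by blast
  have "y \<noteq> 0" using y(3) by auto
  moreover have "y \<noteq> 1/2"
  proof
    assume "y = 1/2"
    from y(3)[unfolded this] show False by (simp add: power_divide)
  qed
  ultimately have "y > 0" "y < 1/2" using y by auto
  then show nu2: "nu < 1/2" using nu_least(3)[of y] y(3) by auto
  have nu3: "nu ^ 3 < 1/8"
    using power_strict_mono[OF nu2, of 3] nu by (simp add: eval_nat_numeral)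
  define z where "z = nu / (2 - nu^3)"
  have z: "z > 0" "z < 1" using nu nu2 nu3 by (auto simp: z_def field_simps)
  have z_eq: "z * (2 - nu^3) = nu" using nu3 by (simp add: z_def)
  define p :: "real \<Rightarrow> real" where "p = (\<lambda>z. 4*z^7 - 12*z^5 - 8*z^4 + 12*z^3 - 20*z^2 + 1)"
  \<comment> \<open>Clearing denominators in \<open>p (nu / d)\<close> gives a multiple of the polynomial defining \<open>nu\<close>.\<close>
  define d where "d = 2 - nu^3"
  have "d^7 * p z = 4 * (z*d)^7 - 12 * (z*d)^5 * d^2 - 8 * (z*d)^4 * d^3 + 12 * (z*d)^3 * d^4 -
      20 * (z*d)^2 * d^5 + d^7"
    unfolding p_def by algebra
  also have "z * d = nu" using z_eq by (simp add: d_def)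
  also have "4 * nu^7 - 12 * nu^5 * d^2 - 8 * nu^4 * d^3 + 12 * nu^3 * d^4 - 20 * nu^2 * d^5 + d^7 =
      (- (nu^14) - 2*nu^13 - 4*nu^12 + 2*nu^11 + 20*nu^10 + 32*nu^9 + 20*nu^8 - 82*nu^7 - 96*nu^6
       - 72*nu^5 + 160*nu^4 + 128*nu^3 + 64*nu^2 - 128*nu - 64) *
      (nu^7 - 2*nu^6 - 4*nu^4 + 4*nu^3 + 4*nu - 2)"
    unfolding d_def by algebra
  also have "\<dots> = 0" using nu_least(2) by simp
  finally have "p z = 0" using nu3 by (simp add: d_def)
  show rho: "0 < rho" by (rule rho_least)
  have "rho \<le> z"
    using rho_least(3)[of z] z \<open>p z = 0\<close> by (simp add: p_def)
  moreover have "\<not> rho < z"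
  proof
    assume less: "rho < z"
    have "p z < p rho"
    proof (rule DERIV_neg_imp_decreasing_open[OF less])
      fix x assume x: "rho < x" "x < z"
      have "(p has_real_derivative 28*x^6 - 60*x^4 - 32*x^3 + 36*x^2 - 40*x) (at x)"
        unfolding p_def by (auto intro!: derivative_eq_intros)
      \<comment> \<open>On (0,1), x^6 \<le> x^4 and x^2 \<le> x let the terms -60 x^4 and -40 x
        dominate the two positive ones.\<close>
      moreover have "28*x^6 - 60*x^4 - 32*x^3 + 36*x^2 - 40*x < 0"
      proof -
        have x01: "0 < x" "x < 1" using x rho z by auto
        have "x^6 \<le> x^4" "x^2 \<le> x^1" using x01 by (intro power_decreasing; simp)+
        moreover have "x^4 > 0" "x^3 > 0" using x01 by auto
        ultimately show ?thesis using x01 unfolding power_one_right by linarith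
      qed
      ultimately show "\<exists>y. (p has_real_derivative y) (at x) \<and> y < 0" by blast
    qed (auto simp: p_def intro!: continuous_intros)
    then show False using \<open>p z = 0\<close> rho_least(2) by (simp add: p_def)
  qed
  ultimately show eq: "rho = nu / (2 - nu^3)" by (simp add: z_def)
  show "rho < nu" unfolding eq using nu nu3 by (simp add: field_simps)
qed

text \<open>These are F = 0 and F_y = 0 at (\<nu>, \<rho>). Substituting \<rho> = \<nu> / (2 -
  \<nu>^3) turns F_y into a multiple of the polynomial defining \<nu>; F is then a combination of
  F_y and the relation between \<rho> and \<nu>.\<close>

lemma rho_nu_critical:
  shows "(nu - rho) * (1 - rho * nu^2) = nu^2"
    and "1 - 3 * rho * nu^2 + 2 * rho^2 * nu - 2 * nu = 0"
proof -
  have nu3: "nu ^ 3 < 1/8"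
    using power_strict_mono[OF rho_nu_bounds(2), of 3] rho_nu_bounds(1) by (simp add: eval_nat_numeral)
  have r: "rho * (2 - nu^3) = nu" using nu3 by (subst rho_nu_bounds(3)) simp
  have "(2 - nu^3)^2 * (1 - 3 * rho * nu^2 + 2 * rho^2 * nu - 2 * nu) =
     (2 - nu^3)^2 * (1 - 2 * nu) - 3 * (rho * (2 - nu^3)) * (2 - nu^3) * nu^2 + 2 * (rho * (2 - nu^3))^2 * nu"
    by algebra
  also have "\<dots> = (-2) * (nu^7 - 2*nu^6 - 4*nu^4 + 4*nu^3 + 4*nu - 2)"
    unfolding r by algebra
  also have "\<dots> = 0" using nu_least(2) by simp
  finally show Fy: "1 - 3 * rho * nu^2 + 2 * rho^2 * nu - 2 * nu = 0" using nu3 by simp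
  have "2 * ((nu - rho) * (1 - rho * nu^2) - nu^2) =
      nu * (1 - 3 * rho * nu^2 + 2 * rho^2 * nu - 2 * nu) + (nu - rho * (2 - nu^3))"
    by algebra
  then show "(nu - rho) * (1 - rho * nu^2) = nu^2" using Fy r by simp
qed

section \<open>The inverse function\<close>

text \<open>\<open>zeta y\<close> is the root \<open>z\<close>, vanishing at \<open>y = 0\<close>, of
  \<open>y\<^sup>2 z\<^sup>2 - (1 + y\<^sup>3) z + y - y\<^sup>2 = 0\<close>, written with the square root in the denominator of
  \<open>y / phi y\<close> so that the formula makes sense at \<open>y = 0\<close>.\<close>

definition zeta_disc :: "complex \<Rightarrow> complex" where
  "zeta_disc y = 1 - 2*y^3 + 4*y^4 + y^6"

definition phi :: "complex \<Rightarrow> complex" where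
  "phi y = (1 + y^3 + csqrt (zeta_disc y)) / (2 * (1 - y))"

definition zeta :: "complex \<Rightarrow> complex" where
  "zeta y = y / phi y"

text \<open>Since 2/8 + 4/16 + 1/64 < 1, the discriminant stays in the right half plane, so its
  principal square root is holomorphic and nonzero.\<close>

lemma Re_zeta_disc_pos:
  assumes "norm y < 1/2"
  shows "Re (zeta_disc y) > 0"
proof -
  have pow: "norm y ^ k \<le> (1/2) ^ k" for k
    using assms by (intro power_mono) auto
  have "norm (- 2*y^3 + 4*y^4 + y^6) \<le> 2 * norm y ^ 3 + 4 * norm y ^ 4 + norm y ^ 6"
    by (intro norm_triangle_le add_mono) (auto simp: norm_mult norm_power)
  also have "\<dots> \<le> 2 * (1/2) ^ 3 + 4 * (1/2) ^ 4 + (1/2) ^ 6"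
    by (intro add_mono mult_left_mono pow) auto
  also have "\<dots> < 1" by (simp add: power_divide)
  finally have "\<bar>Re (- 2*y^3 + 4*y^4 + y^6)\<bar> < 1"
    using abs_Re_le_cmod order.strict_trans1 by blast
  moreover have "Re (zeta_disc y) = 1 + Re (- 2*y^3 + 4*y^4 + y^6)"
    by (simp add: zeta_disc_def)
  ultimately show ?thesis by linarith
qed

lemma zeta_disc_not_nonpos: "norm y < 1/2 \<Longrightarrow> zeta_disc y \<notin> \<real>\<^sub>\<le>\<^sub>0"
  using Re_zeta_disc_pos[of y] by (auto simp: complex_nonpos_Reals_iff)

lemma csqrt_zeta_disc_nonzero: "norm y < 1/2 \<Longrightarrow> csqrt (zeta_disc y) \<noteq> 0"
  using Re_zeta_disc_pos[of y] by auto

lemma phi_nonzero: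
  assumes "norm y < 1/2"
  shows "1 + y^3 + csqrt (zeta_disc y) \<noteq> 0" "1 - y \<noteq> 0" "phi y \<noteq> 0"
proof -
  have "norm (y^3) \<le> (1/2)^3"
    unfolding norm_power using assms by (intro power_mono) auto
  then have "Re (y^3) > -1"
    using abs_Re_le_cmod[of "y^3"] by (simp add: power_divide)
  moreover have "Re (csqrt (zeta_disc y)) \<ge> 0" by (rule Re_csqrt)
  ultimately have "Re (1 + y^3 + csqrt (zeta_disc y)) > 0"
    by (simp only: plus_complex.sel one_complex.sel)
  then show "1 + y^3 + csqrt (zeta_disc y) \<noteq> 0" by (metis less_irrefl zero_complex.sel(1))
  moreover show "1 - y \<noteq> 0" using assms by auto
  ultimately show "phi y \<noteq> 0" by (auto simp: phi_def)
qed

lemma phi_holomorphic: "phi holomorphic_on ball 0 (1/2)"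
proof -
  have "zeta_disc holomorphic_on ball 0 (1/2)"
    unfolding zeta_disc_def by (intro holomorphic_intros)
  then show ?thesis
    unfolding phi_def using zeta_disc_not_nonpos phi_nonzero(2)
    by (intro holomorphic_intros holomorphic_on_csqrt') auto
qed

lemma zeta_holomorphic: "zeta holomorphic_on ball 0 (1/2)"
  unfolding zeta_def using phi_nonzero by (intro holomorphic_intros phi_holomorphic) auto

lemma zeta_nonzero: "norm y < 1/2 \<Longrightarrow> y \<noteq> 0 \<Longrightarrow> zeta y \<noteq> 0"
  using phi_nonzero(3) by (auto simp: zeta_def)

text \<open>The second identity says that the square root is -F_z: it fixes the branch and, being
  nonzero, permits implicit differentiation. Both follow after multiplication by the denominator N
  of \<open>zeta\<close>.\<close>

lemma zeta_curve:
  assumes "norm y < 1/2"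
  shows "(y - zeta y) * (1 - zeta y * y^2) = y^2"
    and "1 + y^3 - 2 * zeta y * y^2 = csqrt (zeta_disc y)"
proof -
  define s where "s = csqrt (zeta_disc y)"
  define N where "N = 1 + y^3 + s"
  have N: "N \<noteq> 0" using phi_nonzero[OF assms] by (simp add: N_def s_def)
  have s2: "s^2 = 1 - 2*y^3 + 4*y^4 + y^6" by (simp add: s_def zeta_disc_def)
  have zN: "zeta y * N = 2 * y * (1 - y)"
    using N phi_nonzero[OF assms] by (simp add: zeta_def phi_def N_def s_def)
  have "N * (1 + y^3 - 2 * zeta y * y^2) = N * (1 + y^3) - 2 * (zeta y * N) * y^2"
    by algebra
  also have "\<dots> = N * s"
    unfolding zN unfolding N_def using s2 by algebra
  finally show eq: "1 + y^3 - 2 * zeta y * y^2 = csqrt (zeta_disc y)"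
    using N by (simp add: s_def)
  have "N * ((y - zeta y) * (1 - zeta y * y^2) - y^2) =
      N * (y - y^2) - (zeta y * N) * (1 + y^3) + (zeta y * N) * zeta y * y^2"
    by algebra
  also have "\<dots> = y * (1 - y) * (N - (1 + y^3) - (1 + y^3 - 2 * zeta y * y^2))"
    unfolding zN by algebra
  also have "\<dots> = 0"
    unfolding eq N_def s_def by simp
  finally show "(y - zeta y) * (1 - zeta y * y^2) = y^2" using N by simp
qed

lemma zeta_cnj:
  assumes "norm y < 1/2"
  shows "phi (cnj y) = cnj (phi y)" "zeta (cnj y) = cnj (zeta y)"
proof -
  have "zeta_disc (cnj y) = cnj (zeta_disc y)" by (simp add: zeta_disc_def)
  moreover have "csqrt (cnj (zeta_disc y)) = cnj (csqrt (zeta_disc y))"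
    using zeta_disc_not_nonpos[OF assms] by (simp add: cnj_csqrt)
  ultimately show "phi (cnj y) = cnj (phi y)" by (simp add: phi_def)
  then show "zeta (cnj y) = cnj (zeta y)" by (simp add: zeta_def)
qed

section \<open>The modulus of \<open>zeta\<close> on the critical circle\<close>

lemma curve_deriv_z_pos: "1 + nu^3 - 2 * rho * nu^2 > 0"
proof -
  have "rho * nu^2 \<le> (1/2) * (1/2)^2"
    using rho_nu_bounds by (intro mult_mono power_mono) auto
  then have "2 * rho * nu^2 \<le> 1/4" by (simp add: power_divide)
  moreover have "nu^3 > 0" using rho_nu_bounds(1) by simp
  ultimately show ?thesis by linarith
qed

text \<open>By the curve equation the discriminant at \<nu> is the square of 1 + \<nu>^3 - 2 \<rho>
  \<nu>^2. Positivity makes this number the principal root, so \<open>zeta\<close> takes the value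
  \<rho> and not the other root of the quadratic.\<close>

lemma zeta_nu: "zeta (of_real nu) = of_real rho"
proof -
  define s where "s = 1 + nu^3 - 2 * rho * nu^2"
  have "zeta_disc (of_real nu) = of_real (1 - 2*nu^3 + 4*nu^4 + nu^6)"
    by (simp add: zeta_disc_def)
  also have "1 - 2*nu^3 + 4*nu^4 + nu^6 = s^2"
    unfolding s_def using rho_nu_critical(1) by algebra
  also have "csqrt (of_real (s^2)) = of_real s"
    using curve_deriv_z_pos by (simp add: s_def of_real_sqrt flip: of_real_sqrt)
  finally have "csqrt (zeta_disc (of_real nu)) = of_real s" .
  moreover have "norm (complex_of_real nu) < 1/2" using rho_nu_bounds by simp
  from zeta_curve(2)[OF this] have "1 + of_real nu^3 - 2 * zeta (of_real nu) * of_real nu^2 = csqrt (zeta_disc (of_real nu))" .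
  ultimately have "1 + of_real nu^3 - 2 * zeta (of_real nu) * of_real nu^2 = (of_real s :: complex)" by simp
  then show ?thesis using rho_nu_bounds(1) by (simp add: s_def)
qed

text \<open>Equality must hold throughout the triangle inequalities
  \<open>\<nu>\<^sup>2 = \<bar>y - z\<bar> \<bar>1 - z y\<^sup>2\<bar> \<ge> (\<nu> - \<rho>) (1 - \<rho> \<nu>\<^sup>2) = \<nu>\<^sup>2\<close>.\<close>

lemma norm_zeta_gt:
  assumes y: "norm y = nu" "y \<noteq> of_real nu"
  shows "norm (zeta y) > rho"
proof (rule ccontr)
  assume contra: "\<not> norm (zeta y) > rho"
  define z where "z = zeta y"
  have z: "norm z \<le> rho" using contra by (simp add: z_def)
  note b = rho_nu_bounds
  have curve: "(y - z) * (1 - z * y^2) = y^2"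
    unfolding z_def using y b by (intro zeta_curve) auto
  have 1: "norm (y - z) \<ge> nu - norm z" using norm_triangle_ineq2[of y z] y by simp
  have zy: "norm (z * y^2) = norm z * nu^2" by (simp add: norm_mult norm_power y)
  have 2: "norm (1 - z * y^2) \<ge> 1 - norm z * nu^2"
    using norm_triangle_ineq2[of 1 "z * y^2"] zy by simp
  have rn: "norm z * nu^2 \<le> rho * nu^2" using z by (intro mult_right_mono) auto
  have rn1: "rho * nu^2 < 1"
  proof -
    have "rho * nu^2 \<le> (1/2) * (1/2)^2"
      using b by (intro mult_mono power_mono) auto
    then show ?thesis by (simp add: power_divide)
  qed
  have prod: "norm (y - z) * norm (1 - z * y^2) = (nu - rho) * (1 - rho * nu^2)"
    using arg_cong[OF curve, of norm] by (simp add: norm_mult norm_power y rho_nu_critical(1))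
  \<comment> \<open>The product of the two moduli equals the product of their lower bounds, so
    neither can exceed its own.\<close>
  have e1: "norm (y - z) = nu - rho"
  proof (rule ccontr)
    assume "norm (y - z) \<noteq> nu - rho"
    then have "norm (y - z) > nu - rho" using 1 z by linarith
    moreover have "1 - rho * nu^2 \<le> norm (1 - z * y^2)" using 2 rn by linarith
    ultimately have "norm (y - z) * norm (1 - z * y^2) > (nu - rho) * (1 - rho * nu^2)"
      using rn1 b(5) by (intro mult_less_le_imp_less) auto
    then show False using prod by simp
  qed
  have e2: "norm (1 - z * y^2) = 1 - rho * nu^2"
    using prod e1 b by simp
  have zr: "norm z = rho" using e1 1 z by linarith
  have "norm z + norm (y - z) = norm (z + (y - z))" using e1 zr y by simp
  then have "norm z *\<^sub>R (y - z) = norm (y - z) *\<^sub>R z"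
    using norm_triangle_eq[of z "y - z"] by simp
  then have yz: "of_real rho * y = of_real nu * z"
    by (simp add: zr e1 scaleR_conv_of_real algebra_simps)
  have "norm (1 - z * y^2) + norm (z * y^2) = norm ((1 - z * y^2) + z * y^2)"
    using e2 zy zr by simp
  then have "norm (1 - z * y^2) *\<^sub>R (z * y^2) = norm (z * y^2) *\<^sub>R (1 - z * y^2)"
    using norm_triangle_eq[of "1 - z * y^2" "z * y^2"] by simp
  then have zy2: "z * y^2 = of_real (rho * nu^2)"
    by (simp add: zy zr e2 scaleR_conv_of_real algebra_simps)
  \<comment> \<open>Equality in the first triangle inequality gives \<rho> y = \<nu> z, in the
    second z y^2 = \<rho> \<nu>^2. Inserted into \<nu> times the curve equation, they leave y
    \<nu>^2 = \<nu> y^2.\<close>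
  have "y * (of_real nu - of_real rho) * (1 - of_real (rho * nu^2)) = of_real nu * y^2"
  proof -
    have "y * (of_real nu - of_real rho) = of_real nu * (y - z)"
      using yz by (simp add: algebra_simps)
    then have "y * (of_real nu - of_real rho) * (1 - of_real (rho * nu^2)) = of_real nu * ((y - z) * (1 - z * y^2))"
      unfolding zy2 by (simp only: mult.assoc)
    then show ?thesis unfolding curve .
  qed
  moreover have "(of_real nu - of_real rho) * (1 - of_real (rho * nu^2)) = (of_real (nu^2) :: complex)"
    using arg_cong[OF rho_nu_critical(1), of complex_of_real]
    by (simp only: of_real_mult of_real_diff of_real_1)
  ultimately have "y * of_real (nu^2) = of_real nu * y^2" by (simp add: mult.assoc)
  then have "of_real nu * y * (y - of_real nu) = 0"
    by (auto simp: power2_eq_square algebra_simps)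
  then show False using y b by auto
qed

section \<open>First and second derivative of \<open>zeta\<close> at the critical point\<close>

definition zeta' :: "complex \<Rightarrow> complex" where
  "zeta' y = (1 - 3 * zeta y * y^2 + 2 * zeta y^2 * y - 2 * y) / (1 + y^3 - 2 * zeta y * y^2)"

lemma zeta_deriv:
  assumes "norm y < 1/2"
  shows "(zeta has_field_derivative zeta' y) (at y)"
proof -
  have "zeta field_differentiable at y"
    using zeta_holomorphic assms by (auto simp: holomorphic_on_open field_differentiable_def)
  then obtain d where d: "(zeta has_field_derivative d) (at y)"
    by (auto simp: field_differentiable_def)
  have "((\<lambda>y. (y - zeta y) * (1 - zeta y * y^2) - y^2) has_field_derivative
      (1 - d) * (1 - zeta y * y^2) - (y - zeta y) * (d * y^2 + zeta y * (2 * y)) - 2 * y) (at y)"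
    by (rule derivative_eq_intros d refl | simp)+ (simp add: algebra_simps)
  moreover have "((\<lambda>y. (y - zeta y) * (1 - zeta y * y^2) - y^2) has_field_derivative 0) (at y)"
  proof (rule has_field_derivative_transform_within)
    show "((\<lambda>_. 0) has_field_derivative 0) (at y)" by simp
    show "0 < 1/2 - norm y" using assms by simp
    fix x assume "dist x y < 1/2 - norm y"
    then have "norm x < 1/2" using norm_triangle_ineq2[of x y] by (simp add: dist_norm)
    then show "0 = (x - zeta x) * (1 - zeta x * x^2) - x^2" using zeta_curve by simp
  qed simp
  ultimately have "(1 - d) * (1 - zeta y * y^2) - (y - zeta y) * (d * y^2 + zeta y * (2 * y)) - 2 * y = 0"
    by (rule DERIV_unique)
  then have "d * (1 + y^3 - 2 * zeta y * y^2) = 1 - 3 * zeta y * y^2 + 2 * zeta y^2 * y - 2 * y"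
    by algebra
  moreover have "1 + y^3 - 2 * zeta y * y^2 \<noteq> 0"
    unfolding zeta_curve(2)[OF assms] by (rule csqrt_zeta_disc_nonzero[OF assms])
  ultimately have "d = zeta' y"
    unfolding zeta'_def by (simp add: field_simps)
  then show ?thesis using d by simp
qed

text \<open>This is F_yy / F_z at (\<nu>, \<rho>): since F_y = 0 there, the second derivative of
  \<open>zeta\<close> at \<nu> is -F_yy / F_z.\<close>

definition zeta_curvature :: real where
  "zeta_curvature = 2 * (3 * rho * nu - rho^2 + 1) / (1 + nu^3 - 2 * rho * nu^2)"

lemma zeta'_nu: "zeta' (of_real nu) = 0"
proof -
  have "1 - 3 * of_real rho * of_real nu^2 + 2 * of_real rho^2 * of_real nu - 2 * of_real nu = (of_real 0 :: complex)"
    unfolding rho_nu_critical(2)[symmetric] by simp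
  then show ?thesis by (simp add: zeta'_def zeta_nu)
qed

lemma zeta_second_deriv: "(zeta' has_field_derivative - of_real zeta_curvature) (at (of_real nu))"
proof -
  have nu: "norm (complex_of_real nu) < 1/2" using rho_nu_bounds by simp
  define num den where "num = (\<lambda>y. 1 - 3 * zeta y * y^2 + 2 * zeta y^2 * y - 2 * y)"
    and "den = (\<lambda>y. 1 + y^3 - 2 * zeta y * y^2)"
  note zd = zeta_deriv[OF nu, unfolded zeta'_nu]
  have num': "(num has_field_derivative of_real (- 6 * rho * nu + 2 * rho^2 - 2)) (at (of_real nu))"
    unfolding num_def
    by (rule derivative_eq_intros zd refl | simp)+ (simp add: zeta_nu algebra_simps)
  have den': "(den has_field_derivative 3 * of_real nu^2 - 2 * of_real rho * (2 * of_real nu)) (at (of_real nu))"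
    unfolding den_def
    by (rule derivative_eq_intros zd refl | simp)+ (simp add: zeta_nu algebra_simps)
  have den0: "den (of_real nu) = of_real (1 + nu^3 - 2 * rho * nu^2)"
    by (simp add: den_def zeta_nu)
  have num0: "num (of_real nu) = 0"
  proof -
    have "num (of_real nu) = of_real (1 - 3 * rho * nu^2 + 2 * rho^2 * nu - 2 * nu)"
      by (simp add: num_def zeta_nu)
    then show ?thesis by (simp only: rho_nu_critical(2) of_real_0)
  qed
  have "den (of_real nu) \<noteq> 0"
    unfolding den0 of_real_eq_0_iff using curve_deriv_z_pos by linarith
  from DERIV_divide[OF num' den' this]
  have "((\<lambda>y. num y / den y) has_field_derivative
      of_real (- 6 * rho * nu + 2 * rho^2 - 2) / den (of_real nu)) (at (of_real nu))"
    using \<open>den (of_real nu) \<noteq> 0\<close> by (simp add: num0)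
  also have "of_real (- 6 * rho * nu + 2 * rho^2 - 2) / den (of_real nu) = - complex_of_real zeta_curvature"
  proof -
    have "(- 6 * rho * nu + 2 * rho^2 - 2) / (1 + nu^3 - 2 * rho * nu^2) = - zeta_curvature"
      unfolding zeta_curvature_def minus_divide_left by (simp add: algebra_simps)
    then show ?thesis unfolding den0 by (simp only: of_real_divide[symmetric] of_real_minus)
  qed
  finally show ?thesis unfolding num_def den_def zeta'_def .
qed

lemma zeta_curvature_pos: "zeta_curvature > 0"
proof -
  have "rho^2 < 1" using rho_nu_bounds by (intro power_less_one_iff[THEN iffD2]) auto
  moreover have "rho * nu > 0" using rho_nu_bounds by simp
  ultimately show ?thesis
    unfolding zeta_curvature_def using curve_deriv_z_pos by (intro divide_pos_pos) auto
qed

section \<open>Formal expansions at 0 and the transfer to coefficients\<close>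

lemma has_fps_expansion_zeta: "zeta has_fps_expansion fps_expansion zeta 0"
  by (rule has_fps_expansion_fps_expansion[OF open_ball _ zeta_holomorphic]) simp

lemma has_fps_expansion_phi: "phi has_fps_expansion fps_expansion phi 0"
  by (rule has_fps_expansion_fps_expansion[OF open_ball _ phi_holomorphic]) simp

lemma eventually_in_half_ball: "\<forall>\<^sub>F y::complex in nhds 0. norm y < 1/2"
  using eventually_nhds_in_open[of "ball (0::complex) (1/2)" 0] by simp

lemma zeta_fps_nth_0: "fps_nth (fps_expansion zeta 0) 0 = 0"
  by (simp add: fps_expansion_def zeta_def)

lemma phi_fps_nth_0: "fps_nth (fps_expansion phi 0) 0 \<noteq> 0"
  using phi_nonzero(3)[of 0] by (simp add: fps_expansion_def)

lemma zeta_phi_fps: "fps_expansion zeta 0 * fps_expansion phi 0 = fps_X"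
proof (rule fps_expansion_unique_complex)
  show "(\<lambda>y. zeta y * phi y) has_fps_expansion fps_expansion zeta 0 * fps_expansion phi 0"
    by (intro fps_expansion_intros has_fps_expansion_zeta has_fps_expansion_phi)
  have "\<forall>\<^sub>F y in nhds 0. zeta y * phi y = y"
    using eventually_in_half_ball by eventually_elim (simp add: zeta_def phi_nonzero(3))
  then have "(\<lambda>y. zeta y * phi y) has_fps_expansion fps_X \<longleftrightarrow> (\<lambda>y. y) has_fps_expansion (fps_X :: complex fps)"
    by (intro has_fps_expansion_cong refl)
  then show "(\<lambda>y. zeta y * phi y) has_fps_expansion fps_X"
    by (simp add: fps_expansion_intros)
qed

lemma zeta_curve_fps:
  defines "Z \<equiv> fps_expansion zeta 0"
  shows "(fps_X - Z) * (1 - Z * fps_X^2) = fps_X^2"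
proof (rule fps_expansion_unique_complex)
  show "(\<lambda>y. (y - zeta y) * (1 - zeta y * y^2)) has_fps_expansion (fps_X - Z) * (1 - Z * fps_X^2)"
    unfolding Z_def by (intro fps_expansion_intros has_fps_expansion_zeta)
  have "\<forall>\<^sub>F y in nhds 0. (y - zeta y) * (1 - zeta y * y^2) = y^2"
    using eventually_in_half_ball by eventually_elim (simp add: zeta_curve)
  then have "(\<lambda>y. (y - zeta y) * (1 - zeta y * y^2)) has_fps_expansion fps_X^2 \<longleftrightarrow>
      (\<lambda>y. y^2) has_fps_expansion (fps_X^2 :: complex fps)"
    by (intro has_fps_expansion_cong refl)
  then show "(\<lambda>y. (y - zeta y) * (1 - zeta y * y^2)) has_fps_expansion fps_X^2"
    by (simp add: fps_expansion_intros)
qed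

text \<open>Along y = \<nu> exp(i t), \<open>zeta\<close> behaves like \<rho> +
  \<open>zeta_curvature\<close> \<nu>^2 t^2 / 2, so \<rho> / \<open>zeta\<close> is 1 -
  \<open>kappa\<close> t^2 / 2 to second order. Moving off the real axis turns the maximum of
  \<open>zeta\<close> at \<nu> into a minimum.\<close>

definition kappa :: real where
  "kappa = zeta_curvature * nu^2 / rho"

lemma kappa_pos: "kappa > 0"
  unfolding kappa_def using zeta_curvature_pos rho_nu_bounds by simp

text \<open>The assumption on W encodes W(z) = H(y(z)), and A is H'. After Lagrange inversion and
  Cauchy's formula, n W_n \<rho>^n is 1/\<pi> times the integral of Re (g h^n), with h = \<rho> /
  \<open>zeta\<close> on the circle. The constant is (1/\<pi>) sqrt(2 \<pi> / \<open>kappa\<close>)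
  / 2 = 1 / sqrt(2 \<pi> \<open>kappa\<close>).\<close>

lemma inverse_zeta_coeff_asymptotics:
  fixes H A :: "complex \<Rightarrow> complex" and W :: "complex fps"
  assumes H: "\<And>y. norm y < 1/2 \<Longrightarrow> (H has_field_derivative A y) (at y)"
    and A: "A holomorphic_on ball 0 (1/2)"
    and A_sym: "\<And>y. norm y < 1/2 \<Longrightarrow> A (cnj y) = cnj (A y)"
    and W: "W oo fps_expansion zeta 0 = fps_expansion H 0"
  shows "(\<lambda>n. real n * Re (fps_nth W n) * rho ^ n -
           nu * Re (A (of_real nu)) / sqrt (2 * pi * kappa) * real n powr (-1/2)) \<in> O(\<lambda>n. real n powr (-3/2))"
proof -
  define E where "E = (\<lambda>w. of_real nu * exp (\<i> * w))"
  define g where "g = (\<lambda>w. A (E w) * E w)"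
  define h where "h = (\<lambda>w. of_real rho / zeta (E w))"
  define h' where "h' = (\<lambda>w. - of_real rho * (zeta' (E w) * (\<i> * E w)) / zeta (E w) ^ 2)"
  \<comment> \<open>Chosen so that \<nu> exp r = 1/2: the circle parametrization then extends to
    complex w with |w| < r while staying in the disc.\<close>
  define r where "r = ln (1 / (2 * nu))"
  note b = rho_nu_bounds
  have r: "r > 0" using b by (simp add: r_def)
  have norm_E: "norm (E w) < 1/2" if "norm w < r" for w
  proof -
    have "norm (E w) = nu * exp (Re (\<i> * w))" using b by (simp add: E_def norm_mult)
    also have "Re (\<i> * w) \<le> norm w" using abs_Im_le_cmod[of w] by simp
    also have "\<dots> < r" by (rule that)
    also have "nu * exp r = 1/2" using b by (simp add: r_def)
    finally show ?thesis using b by simp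
  qed
  have E_real: "E (of_real t) = of_real nu * cis t" for t by (simp add: E_def cis_conv_exp)
  have norm_E_real: "norm (E (of_real t)) = nu" for t using b by (simp add: E_real norm_mult)
  have E_nz: "E w \<noteq> 0" for w using b by (simp add: E_def)
  have E_cnj: "E (of_real (-t)) = cnj (E (of_real t))" for t
    unfolding E_real by (simp add: cis_cnj)
  have E_deriv: "(E has_field_derivative \<i> * E w) (at w)" for w
    unfolding E_def by (auto intro!: derivative_eq_intros)
  have E0: "E 0 = of_real nu" by (simp add: E_def)
  have A_cont: "continuous_on {0..pi} (\<lambda>t. A (E (of_real t)))"
    unfolding E_real
    using b by (intro continuous_on_compose2[OF holomorphic_on_imp_continuous_on[OF A]] continuous_intros)
      (auto simp: norm_mult)
  have zeta_cont: "continuous_on {0..pi} (\<lambda>t. zeta (E (of_real t)))"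
    unfolding E_real
    using b by (intro continuous_on_compose2[OF holomorphic_on_imp_continuous_on[OF zeta_holomorphic]] continuous_intros)
      (auto simp: norm_mult)
  have zeta_E_nz: "zeta (E (of_real t)) \<noteq> 0" for t
    using norm_E_real b E_nz by (intro zeta_nonzero) auto

  have laplace: "(\<lambda>n. integral {0..pi} (\<lambda>t. Re (g (of_real t) * h (of_real t) ^ n)) -
           Re (g 0) * (sqrt (2 * pi / (kappa * real n)) / 2)) \<in> O(\<lambda>n. real n powr (-3/2))"
  proof (rule Laplace_symmetric[where r = r and h' = h'])
    show "r > 0" "kappa > 0" "pi > 0" using r kappa_pos by auto
    have "E holomorphic_on ball 0 r" unfolding E_def by (intro holomorphic_intros)
    moreover from this have "(A \<circ> E) holomorphic_on ball 0 r"
      by (rule holomorphic_on_compose_gen[OF _ A]) (use norm_E in auto)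
    ultimately show "g holomorphic_on ball 0 r"
      unfolding g_def o_def by (intro holomorphic_intros)
    show "g (of_real (-t)) = cnj (g (of_real t))" for t
      unfolding g_def E_cnj using norm_E_real[of t] b by (simp add: A_sym)
    show "h (of_real (-t)) = cnj (h (of_real t))" for t
      unfolding h_def E_cnj using norm_E_real[of t] b by (simp add: zeta_cnj)
    show "h 0 = 1" using b by (simp add: h_def E0 zeta_nu)
    show "(h has_field_derivative h' w) (at w)" if "w \<in> ball 0 r" for w
    proof -
      have w: "norm (E w) < 1/2" using that norm_E by simp
      have "((\<lambda>w. zeta (E w)) has_field_derivative zeta' (E w) * (\<i> * E w)) (at w)"
        by (rule DERIV_chain2[OF zeta_deriv[OF w] E_deriv])
      from DERIV_divide[OF DERIV_const this zeta_nonzero[OF w E_nz], of "of_real rho"]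
      show ?thesis unfolding h_def h'_def by (simp add: power2_eq_square)
    qed
    show "h' 0 = 0" by (simp add: h'_def E0 zeta'_nu)
    show "(h' has_field_derivative - of_real kappa) (at 0)"
    proof -
      have n0: "norm (E 0) < 1/2" using norm_E[of 0] r by simp
      have z': "((\<lambda>w. zeta' (E w)) has_field_derivative - of_real zeta_curvature * (\<i> * E 0)) (at 0)"
        by (rule DERIV_chain2[OF _ E_deriv]) (simp add: E0 zeta_second_deriv)
      have z: "((\<lambda>w. zeta (E w)) has_field_derivative 0) (at 0)"
        using DERIV_chain2[OF zeta_deriv[OF n0] E_deriv] by (simp add: E0 zeta'_nu)
      have z2: "((\<lambda>w. zeta (E w) ^ 2) has_field_derivative 0) (at 0)"
        using DERIV_power[OF z, of 2] by simp
      have z2nz: "zeta (E 0) ^ 2 \<noteq> 0" using b by (simp add: E0 zeta_nu)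
      note d = DERIV_divide[OF DERIV_cmult[OF DERIV_mult[OF z' DERIV_cmult[OF E_deriv]]] z2 z2nz, of "- of_real rho" "\<i>"]
      have "(h' has_field_derivative
          - of_real rho * (- of_real zeta_curvature * (\<i> * of_real nu) * (\<i> * of_real nu)) / of_real rho ^ 2) (at 0)"
        unfolding h'_def using d b by (simp add: E0 zeta'_nu zeta_nu power2_eq_square)
      also have "- of_real rho * (- of_real zeta_curvature * (\<i> * of_real nu) * (\<i> * of_real nu)) / of_real rho ^ 2 =
          - complex_of_real kappa"
        using b(4) by (simp add: kappa_def power2_eq_square field_simps)
      finally show ?thesis .
    qed
    show "continuous_on {0..pi} (\<lambda>t. g (of_real t))"
      unfolding g_def using A_cont unfolding E_real by (intro continuous_intros)
    show "continuous_on {0..pi} (\<lambda>t. h (of_real t))"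
      unfolding h_def by (intro continuous_intros zeta_cont) (use zeta_E_nz in auto)
    show "norm (h (of_real t)) < 1" if t: "0 < t" "t \<le> pi" for t
    proof -
      have "cos t < 1" using cos_monotone_0_pi[of 0 t] t by simp
      then have "cis t \<noteq> 1" by (metis cis.sel(1) less_irrefl one_complex.sel(1))
      then have "E (of_real t) \<noteq> of_real nu" using b by (simp add: E_real)
      from norm_zeta_gt[OF norm_E_real this] show ?thesis
        using b(4) by (auto simp: h_def norm_divide divide_less_eq)
    qed
  qed

  have coeff: "real n * Re (fps_nth W n) * rho ^ n =
      integral {0..pi} (\<lambda>t. Re (g (of_real t) * h (of_real t) ^ n)) / pi" if n: "n > 0" for n
  proof -
    define f where "f = (\<lambda>y. A y * phi y ^ n)"
    have H_holo: "H holomorphic_on ball 0 (1/2)"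
      using H by (subst holomorphic_on_open[OF open_ball]) (metis mem_ball_0)
    have "H has_fps_expansion fps_expansion H 0"
      by (rule has_fps_expansion_fps_expansion[OF open_ball _ H_holo]) simp
    then have "deriv H has_fps_expansion fps_deriv (fps_expansion H 0)"
      by (rule has_fps_expansion_deriv)
    also have "?this \<longleftrightarrow> A has_fps_expansion fps_deriv (fps_expansion H 0)"
      by (intro has_fps_expansion_cong refl eventually_mono[OF eventually_in_half_ball])
         (rule DERIV_imp_deriv[OF H])
    finally have "f has_fps_expansion fps_deriv (fps_expansion H 0) * fps_expansion phi 0 ^ n"
      unfolding f_def by (intro fps_expansion_intros has_fps_expansion_phi)
    then have "fps_nth (fps_deriv (fps_expansion H 0) * fps_expansion phi 0 ^ n) (n - 1) =
        (deriv ^^ (n - 1)) f 0 / fact (n - 1)"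
      by (rule fps_nth_fps_expansion)
    with fps_Lagrange_inversion[OF zeta_phi_fps phi_fps_nth_0 n, of W]
    have "of_nat n * fps_nth W n = (deriv ^^ (n - 1)) f 0 / fact (n - 1)"
      by (simp add: W)
    then have "Re (of_nat n * fps_nth W n) = Re ((deriv ^^ (n - 1)) f 0 / fact (n - 1))"
      by (rule arg_cong)
    then have "real n * Re (fps_nth W n) = Re ((deriv ^^ (n - 1)) f 0 / fact (n - 1))"
      by simp
    also have "\<dots> = integral {0..pi} (\<lambda>t. Re (f (of_real nu * cis t) / (of_real nu * cis t) ^ (n - 1))) / pi"
    proof (rule Re_Taylor_coeff_eq_half_circle_integral)
      show "f holomorphic_on ball 0 (1/2)"
        unfolding f_def by (intro holomorphic_intros A phi_holomorphic)
      show "f (cnj y) = cnj (f y)" if "norm y = nu" for y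
        using that b by (simp add: f_def A_sym zeta_cnj)
    qed (use b in auto)
    also have "(\<lambda>t. Re (f (of_real nu * cis t) / (of_real nu * cis t) ^ (n - 1))) =
        (\<lambda>t. Re (g (of_real t) * h (of_real t) ^ n) * inverse (rho ^ n))"
    proof
      fix t :: real
      define y where "y = of_real nu * cis t"
      have y: "norm y < 1/2" "y \<noteq> 0" using b by (auto simp: y_def norm_mult)
      \<comment> \<open>The extra factor y in g, from dy = i y dt, turns the power n of
        \<open>phi\<close> y / y into the denominator y^(n-1) of Cauchy's formula.\<close>
      have "g (of_real t) * h (of_real t) ^ n = A y * y * (of_real rho * phi y / y) ^ n"
        using phi_nonzero(3)[OF y(1)] by (simp add: g_def h_def E_real zeta_def flip: y_def)
      also have "\<dots> = of_real (rho ^ n) * (f y / y ^ (n - 1))"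
        using n y(2) by (cases n) (auto simp: f_def power_mult_distrib power_divide field_simps)
      finally have eq: "g (of_real t) * h (of_real t) ^ n = of_real (rho ^ n) * (f y / y ^ (n - 1))" .
      define X where "X = f y / y ^ (n - 1)"
      have "Re (g (of_real t) * h (of_real t) ^ n) = rho ^ n * Re X"
        unfolding eq X_def[symmetric] by simp
      then show "Re (f (of_real nu * cis t) / (of_real nu * cis t) ^ (n - 1)) =
          Re (g (of_real t) * h (of_real t) ^ n) * inverse (rho ^ n)"
        unfolding y_def[symmetric] X_def[symmetric] using b(4) by simp
    qed
    also have "integral {0..pi} \<dots> = integral {0..pi} (\<lambda>t. Re (g (of_real t) * h (of_real t) ^ n)) * inverse (rho ^ n)"
      by (rule integral_mult_left)
    finally show ?thesis using b by (simp add: field_simps)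
  qed

  have "(\<lambda>n. 1 / pi * (integral {0..pi} (\<lambda>t. Re (g (of_real t) * h (of_real t) ^ n)) -
           Re (g 0) * (sqrt (2 * pi / (kappa * real n)) / 2))) \<in> O(\<lambda>n. real n powr (-3/2))"
    using laplace by simp
  also have "?this \<longleftrightarrow> ?thesis"
  proof (intro landau_o.big.in_cong eventually_mono[OF eventually_gt_at_top[of 0]])
    fix n :: nat assume n: "n > 0"
    have g0: "Re (g 0) = nu * Re (A (of_real nu))" by (simp add: g_def E0)
    have S: "1 / pi * (sqrt (2 * pi / (kappa * real n)) / 2) = 1 / sqrt (2 * pi * kappa) * real n powr (-1/2)"
    proof -
      have "sqrt (2 * pi / (kappa * real n)) = sqrt (2 * pi) / sqrt kappa * real n powr (-1/2)"
        using n by (simp add: real_sqrt_divide real_sqrt_mult powr_minus powr_half_sqrt field_simps)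
      moreover have "1 / pi * (sqrt (2 * pi) / 2) = 1 / sqrt (2 * pi)"
      proof -
        have "sqrt (2 * pi) * sqrt (2 * pi) = 2 * pi" by (rule real_sqrt_mult_self[THEN trans]) simp
        then show ?thesis by (simp add: divide_simps mult_ac del: real_sqrt_mult_self)
      qed
      moreover have "1 / pi * (sqrt (2 * pi) / sqrt kappa * u / 2) = (1 / pi * (sqrt (2 * pi) / 2)) * (u / sqrt kappa)" for u
        by simp
      moreover have "1 / sqrt (2 * pi) * (u / sqrt kappa) = 1 / sqrt (2 * pi * kappa) * u" for u
        by (simp add: real_sqrt_mult)
      ultimately show ?thesis by (simp only:)
    qed
    have "1 / pi * (I - G * S) = I / pi - G * (1 / pi * S)" for I G S :: real
      by (simp add: algebra_simps)
    then show "1 / pi * (integral {0..pi} (\<lambda>t. Re (g (of_real t) * h (of_real t) ^ n)) -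
           Re (g 0) * (sqrt (2 * pi / (kappa * real n)) / 2)) =
         real n * Re (fps_nth W n) * rho ^ n -
           nu * Re (A (of_real nu)) / sqrt (2 * pi * kappa) * real n powr (-1/2)"
      unfolding coeff[OF n] by (simp only: S g0) simp
  qed
  finally show ?thesis .
qed

section \<open>The series \<open>P\<close> and \<open>Q\<close>\<close>

definition fps_of_real :: "real fps \<Rightarrow> complex fps" where
  "fps_of_real f = Abs_fps (\<lambda>n. of_real (fps_nth f n))"

lemma fps_of_real_nth [simp]: "fps_nth (fps_of_real f) n = of_real (fps_nth f n)"
  by (simp add: fps_of_real_def)

lemma fps_of_real_simps [simp]:
  "fps_of_real (f * g) = fps_of_real f * fps_of_real g"
  "fps_of_real (f - g) = fps_of_real f - fps_of_real g"
  "fps_of_real 1 = 1" "fps_of_real fps_X = fps_X"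
  by (auto simp: fps_eq_iff fps_mult_nth)

lemma fps_of_real_power [simp]: "fps_of_real (f ^ n) = fps_of_real f ^ n"
  by (induction n) auto

lemma P_ser_curve: "(P_ser - 1) * (1 - fps_X^3 * P_ser^2) = fps_X * P_ser^2"
proof -
  have "(P_ser - 1) * (1 - fps_X^3 * P_ser^2) =
      fps_X * P_ser^2 / (1 - fps_X^3 * P_ser^2) * (1 - fps_X^3 * P_ser^2)"
    by (subst (1) P_ser_eq) simp
  also have "\<dots> = fps_X * P_ser^2"
    by (simp add: fps_divide_unit mult.assoc inverse_mult_eq_1)
  finally show ?thesis .
qed

lemma Q_ser_curve: "(Q_ser - 1) * (1 - fps_X^3 * P_ser^3) = fps_X * P_ser^2"
  unfolding Q_ser_def by (simp add: fps_divide_unit mult.assoc inverse_mult_eq_1)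

text \<open>The composite and X itself both satisfy F(y, Z) = 0. Their difference times a cofactor u
  is therefore 0, and u has constant term 1, so the absence of zero divisors forces
  equality.\<close>

lemma zeta_inverse_fps:
  defines "Z \<equiv> fps_expansion zeta 0"
  shows "(fps_X * fps_of_real P_ser) oo Z = fps_X"
proof -
  have Z0: "fps_nth Z 0 = 0" unfolding Z_def by (rule zeta_fps_nth_0)
  define p where "p = fps_of_real P_ser oo Z"
  define y where "y = (fps_X * fps_of_real P_ser) oo Z"
  have y: "y = Z * p"
    unfolding y_def p_def by (simp add: fps_compose_mult_distrib Z0)
  have "(fps_of_real P_ser - 1) * (1 - fps_X^3 * fps_of_real P_ser^2) = fps_X * fps_of_real P_ser^2"
    using arg_cong[OF P_ser_curve, of fps_of_real] by simp
  from arg_cong[OF this, of "\<lambda>f. f oo Z"]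
  have "(p - 1) * (1 - Z^3 * p^2) = Z * p^2"
    by (simp add: fps_compose_mult_distrib fps_compose_sub_distrib Z0 p_def flip: fps_compose_power)
  then have 1: "(y - Z) * (1 - Z * y^2) = y^2"
    unfolding y by algebra
  have 2: "(fps_X - Z) * (1 - Z * fps_X^2) = fps_X^2"
    unfolding Z_def by (rule zeta_curve_fps)
  \<comment> \<open>The divided difference of F(., Z) between y and X.\<close>
  define u where "u = 1 - Z * (y^2 + y * fps_X + fps_X^2) + Z^2 * (y + fps_X) - (y + fps_X)"
  have "(y - fps_X) * u = ((y - Z) * (1 - Z * y^2) - y^2) - ((fps_X - Z) * (1 - Z * fps_X^2) - fps_X^2)"
    unfolding u_def by algebra
  also have "\<dots> = 0" using 1 2 by simp
  finally have "(y - fps_X) * u = 0" .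
  moreover have "fps_nth u 0 = 1" by (simp add: u_def Z0 y power2_eq_square)
  then have "u \<noteq> 0" by auto
  ultimately show ?thesis by (simp add: y_def)
qed

lemma one_minus_cube_nonzero:
  fixes y :: complex
  assumes "norm y < 1/2"
  shows "1 - y^3 \<noteq> 0"
proof
  assume "1 - y^3 = 0"
  then have "norm (y^3) = 1" by simp
  moreover have "norm y ^ 3 < 1" using assms by (intro power_less_one_iff[THEN iffD2]) auto
  ultimately show False by (simp add: norm_power)
qed

text \<open>Multiplying the equation of Q by z leaves only powers of y = z P besides z (Q - 1).
  Subtracting 1 from Q is what removes the separate summand z.\<close>

lemma Q_ser_inverse_fps:
  defines "Z \<equiv> fps_expansion zeta 0"
  shows "((fps_X * fps_of_real (Q_ser - 1)) oo Z) = fps_expansion (\<lambda>y. y^2 / (1 - y^3)) 0"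
proof -
  have Z0: "fps_nth Z 0 = 0" unfolding Z_def by (rule zeta_fps_nth_0)
  define p q where "p = fps_of_real P_ser oo Z" and "q = fps_of_real (Q_ser - 1) oo Z"
  have Zp: "Z * p = fps_X"
    using zeta_inverse_fps by (simp add: p_def fps_compose_mult_distrib Z0 flip: Z_def)
  have "fps_of_real (Q_ser - 1) * (1 - fps_X^3 * fps_of_real P_ser^3) = fps_X * fps_of_real P_ser^2"
    using arg_cong[OF Q_ser_curve, of fps_of_real] by simp
  from arg_cong[OF this, of "\<lambda>f. f oo Z"]
  have "q * (1 - Z^3 * p^3) = Z * p^2"
    by (simp add: fps_compose_mult_distrib fps_compose_sub_distrib Z0 p_def q_def
      del: fps_of_real_simps flip: fps_compose_power)
  then have "Z * q * (1 - (Z * p)^3) = (Z * p)^2" by algebra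
  then have 1: "Z * q * (1 - fps_X^3) = fps_X^2" by (simp only: Zp)
  define F where "F = fps_expansion (\<lambda>y::complex. y^2 / (1 - y^3)) 0"
  note nz = one_minus_cube_nonzero
  have "(\<lambda>y::complex. y^2 / (1 - y^3)) holomorphic_on ball 0 (1/2)"
    using nz by (intro holomorphic_intros) auto
  then have "(\<lambda>y::complex. y^2 / (1 - y^3)) has_fps_expansion F"
    unfolding F_def by (intro has_fps_expansion_fps_expansion[OF open_ball]) auto
  then have "(\<lambda>y::complex. y^2 / (1 - y^3) * (1 - y^3)) has_fps_expansion F * (1 - fps_X^3)"
    by (intro fps_expansion_intros)
  also have "?this \<longleftrightarrow> (\<lambda>y::complex. y^2) has_fps_expansion F * (1 - fps_X^3)"
    by (intro has_fps_expansion_cong refl eventually_mono[OF eventually_in_half_ball]) (drule nz, simp)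
  finally have 2: "F * (1 - fps_X^3) = fps_X^2"
    by (rule fps_expansion_unique_complex) (intro fps_expansion_intros)
  have "fps_nth (1 - fps_X^3 :: complex fps) 0 \<noteq> 0" by simp
  then have "(1 - fps_X^3 :: complex fps) \<noteq> 0" by (metis fps_zero_nth)
  with 1 2 have "Z * q = F" by (metis mult_right_cancel)
  then show ?thesis
    unfolding F_def q_def by (simp add: fps_compose_mult_distrib Z0 del: fps_of_real_simps)
qed

text \<open>Matches the stated radical with the Laplace constant \<nu> / sqrt(2 \<pi>
  \<open>kappa\<close>); sqrt \<pi> is the normalization in the statement and 1/\<rho> the index
  shift.\<close>

lemma gamma_P_eq: "gamma_P = nu / sqrt (2 * pi * kappa) * sqrt pi / rho"
proof -
  define s t where "s = 1 + nu^3 - 2 * rho * nu^2" and "t = 3 * rho * nu - rho^2 + 1"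
  note b = rho_nu_bounds
  have s: "s > 0" using curve_deriv_z_pos by (simp add: s_def)
  have curv: "zeta_curvature = 2 * t / s" by (simp add: zeta_curvature_def s_def t_def)
  have t: "t > 0" using zeta_curvature_pos s unfolding curv by (simp add: zero_less_divide_iff)
  have "nu / sqrt (2 * pi * kappa) * sqrt pi / rho = sqrt (nu^2 * pi / (2 * pi * kappa * rho^2))"
    using b by (simp add: real_sqrt_divide real_sqrt_mult)
  also have "nu^2 * pi / (2 * pi * kappa * rho^2) = (1/2)^2 * (s / (rho * t))"
    using b(1,4) s t by (simp add: kappa_def curv field_simps power2_eq_square)
  also have "sqrt \<dots> = 1/2 * sqrt (s / (rho * t))"
    by (simp add: real_sqrt_mult real_sqrt_divide)
  also have "s = nu^3 - 2*rho*nu^2 + 1" by (simp add: s_def)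
  finally show ?thesis by (simp add: gamma_P_def t_def)
qed

lemma gamma_P_pos: "gamma_P > 0"
  unfolding gamma_P_eq using rho_nu_bounds kappa_pos by simp

lemma nu_cube_less_1: "nu ^ 3 < 1"
  using rho_nu_bounds by (intro power_less_one_iff[THEN iffD2]) auto

lemma P_ser_coeff_asymptotics:
  "(\<lambda>n. real n * fps_nth (fps_X * P_ser) n * rho ^ n - gamma_P * rho / sqrt pi * real n powr (-1/2))
     \<in> O(\<lambda>n. real n powr (-3/2))"
proof -
  have "(\<lambda>n. real n * Re (fps_nth (fps_X * fps_of_real P_ser) n) * rho ^ n -
      nu * Re 1 / sqrt (2 * pi * kappa) * real n powr (-1/2)) \<in> O(\<lambda>n. real n powr (-3/2))"
  proof (rule inverse_zeta_coeff_asymptotics[where H = "\<lambda>y. y" and A = "\<lambda>_. 1"])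
    have "(\<lambda>y. y) has_fps_expansion fps_expansion (\<lambda>y. y) 0"
      by (rule has_fps_expansion_fps_expansion[of UNIV]) auto
    then have "fps_expansion (\<lambda>y. y) 0 = fps_X"
      by (rule fps_expansion_unique_complex) (rule fps_expansion_intros)
    then show "(fps_X * fps_of_real P_ser) oo fps_expansion zeta 0 = fps_expansion (\<lambda>y. y) 0"
      using zeta_inverse_fps by simp
  qed auto
  also have "nu * Re 1 / sqrt (2 * pi * kappa) = gamma_P * rho / sqrt pi"
    unfolding gamma_P_eq using rho_nu_bounds(4) by simp
  also have "(\<lambda>n. Re (fps_nth (fps_X * fps_of_real P_ser) n)) = fps_nth (fps_X * P_ser)"
    by (auto simp: fun_eq_iff)
  finally show ?thesis by (simp add: fun_eq_iff)
qed

text \<open>The factor by which \<open>gamma_Q\<close> differs from \<open>gamma_P\<close> is the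
  derivative of y^2 / (1 - y^3) at \<nu>.\<close>

lemma Q_ser_coeff_asymptotics:
  "(\<lambda>n. real n * fps_nth (fps_X * (Q_ser - 1)) n * rho ^ n - gamma_Q * rho / sqrt pi * real n powr (-1/2))
     \<in> O(\<lambda>n. real n powr (-3/2))"
proof -
  define A where "A = (\<lambda>y::complex. y * (2 + y^3) / (1 - y^3)^2)"
  note nz = one_minus_cube_nonzero
  have "(\<lambda>n. real n * Re (fps_nth (fps_X * fps_of_real (Q_ser - 1)) n) * rho ^ n -
      nu * Re (A (of_real nu)) / sqrt (2 * pi * kappa) * real n powr (-1/2)) \<in> O(\<lambda>n. real n powr (-3/2))"
  proof (rule inverse_zeta_coeff_asymptotics[where H = "\<lambda>y. y^2 / (1 - y^3)"])
    fix y :: complex assume y: "norm y < 1/2"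
    have "((\<lambda>y. y^2) has_field_derivative 2 * y) (at y)"
      "((\<lambda>y. 1 - y^3) has_field_derivative - (3 * y^2)) (at y)"
      by (auto intro!: derivative_eq_intros)
    note d = DERIV_divide[OF this nz[OF y]]
    have "2 * y * (1 - y^3) - y^2 * - (3 * y^2) = y * (2 + y^3)" by algebra
    with d show "((\<lambda>y. y^2 / (1 - y^3)) has_field_derivative A y) (at y)"
      unfolding A_def power2_eq_square[of "1 - y^3"] by (simp only:)
    show "A (cnj y) = cnj (A y)" by (simp add: A_def)
  next
    show "A holomorphic_on ball 0 (1/2)"
      unfolding A_def using nz by (intro holomorphic_intros) auto
  qed (rule Q_ser_inverse_fps)
  also have "A (of_real nu) = of_real (nu * (nu^3 + 2) / (nu^3 - 1)^2)"
    by (simp add: A_def power2_commute[of 1] add.commute)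
  also have "nu * Re (of_real (nu * (nu^3 + 2) / (nu^3 - 1)^2)) / sqrt (2 * pi * kappa) = gamma_Q * rho / sqrt pi"
    unfolding gamma_Q_def gamma_P_eq using rho_nu_bounds(4) by simp
  also have "(\<lambda>n. Re (fps_nth (fps_X * fps_of_real (Q_ser - 1)) n)) = fps_nth (fps_X * (Q_ser - 1))"
    by (auto simp: fun_eq_iff)
  finally show ?thesis by (simp add: fun_eq_iff)
qed

lemma P_ser_asymptotics:
  shows "\<exists>e \<in> O(\<lambda>n. 1 / real n). \<forall>\<^sub>F n in sequentially.
      fps_nth P_ser n = gamma_P * rho powi (- int n) / (sqrt pi * real n powr (3/2)) * (1 + e n)"
    and "(\<lambda>n. fps_nth P_ser n * rho ^ n * real n powr (3/2)) \<longlonglongrightarrow> gamma_P / sqrt pi"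
proof -
  note * = shifted_coeff_asymptotics[OF _ rho_nu_bounds(4) _ P_ser_coeff_asymptotics,
      of gamma_P "fps_nth P_ser"]
  show "\<exists>e \<in> O(\<lambda>n. 1 / real n). \<forall>\<^sub>F n in sequentially.
      fps_nth P_ser n = gamma_P * rho powi (- int n) / (sqrt pi * real n powr (3/2)) * (1 + e n)"
    using gamma_P_pos rho_nu_bounds(4) by (intro *(1)) auto
  show "(\<lambda>n. fps_nth P_ser n * rho ^ n * real n powr (3/2)) \<longlonglongrightarrow> gamma_P / sqrt pi"
    using *(2) gamma_P_pos rho_nu_bounds(4) by simp
qed

lemma gamma_Q_pos: "gamma_Q > 0"
  unfolding gamma_Q_def using gamma_P_pos nu_cube_less_1 rho_nu_bounds(1)
  by (intro mult_pos_pos divide_pos_pos add_pos_pos) auto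

lemma Q_ser_asymptotics:
  shows "\<exists>e \<in> O(\<lambda>n. 1 / real n). \<forall>\<^sub>F n in sequentially.
      fps_nth Q_ser n = gamma_Q * rho powi (- int n) / (sqrt pi * real n powr (3/2)) * (1 + e n)"
    and "(\<lambda>n. fps_nth Q_ser n * rho ^ n * real n powr (3/2)) \<longlonglongrightarrow> gamma_Q / sqrt pi"
proof -
  have ev: "\<forall>\<^sub>F n in sequentially. fps_nth Q_ser n = fps_nth (fps_X * (Q_ser - 1)) (Suc n)"
    using eventually_gt_at_top[of 0] by eventually_elim simp
  note * = shifted_coeff_asymptotics[OF _ rho_nu_bounds(4) _ Q_ser_coeff_asymptotics ev, of gamma_Q]
  show "\<exists>e \<in> O(\<lambda>n. 1 / real n). \<forall>\<^sub>F n in sequentially.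
      fps_nth Q_ser n = gamma_Q * rho powi (- int n) / (sqrt pi * real n powr (3/2)) * (1 + e n)"
    using gamma_Q_pos rho_nu_bounds(4) by (intro *(1)) auto
  show "(\<lambda>n. fps_nth Q_ser n * rho ^ n * real n powr (3/2)) \<longlonglongrightarrow> gamma_Q / sqrt pi"
    using *(2) gamma_Q_pos rho_nu_bounds(4) by simp
qed

section \<open>Behaviour of the series at \<rho>\<close>

lemmas P_ser_at_rho =
  square_root_singularity_consequences[OF rho_nu_bounds(4) divide_pos_pos[OF gamma_P_pos real_sqrt_gt_zero[OF pi_gt_zero]] P_ser_asymptotics(2)]

lemmas Q_ser_at_rho =
  square_root_singularity_consequences[OF rho_nu_bounds(4) divide_pos_pos[OF gamma_Q_pos real_sqrt_gt_zero[OF pi_gt_zero]] Q_ser_asymptotics(2)]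

text \<open>Inside the radius of convergence evaluation respects products and differences. At \<rho>
  itself the identities follow as left limits, by continuity of the sums up to the end
  point.\<close>

lemma eval_ser_curves:
  assumes "0 \<le> x" "x \<le> rho"
  defines "p \<equiv> eval_fps P_ser x" and "q \<equiv> eval_fps Q_ser x"
  shows "(p - 1) * (1 - x^3 * p^2) = x * p^2" "(q - 1) * (1 - x^3 * p^3) = x * p^2"
proof -
  have open_case: "(eval_fps P_ser x - 1) * (1 - x^3 * eval_fps P_ser x^2) = x * eval_fps P_ser x^2 \<and>
      (eval_fps Q_ser x - 1) * (1 - x^3 * eval_fps P_ser x^3) = x * eval_fps P_ser x^2"
    if x: "0 \<le> x" "x < rho" for x
  proof -
    have P: "ereal \<bar>x\<bar> < fps_conv_radius P_ser" and Q: "ereal \<bar>x\<bar> < fps_conv_radius Q_ser"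
      using x P_ser_at_rho(2) Q_ser_at_rho(2) by auto
    have X: "ereal \<bar>x\<bar> < fps_conv_radius (fps_X :: real fps)" and one: "ereal \<bar>x\<bar> < fps_conv_radius (1 :: real fps)"
      by auto
    have pow: "ereal \<bar>x\<bar> < fps_conv_radius (f ^ k)" if "ereal \<bar>x\<bar> < fps_conv_radius f" for f :: "real fps" and k
      using that fps_conv_radius_power[of f k] by (rule less_le_trans)
    have mult: "ereal \<bar>x\<bar> < fps_conv_radius (f * g)"
      if "ereal \<bar>x\<bar> < fps_conv_radius f" "ereal \<bar>x\<bar> < fps_conv_radius g" for f g :: "real fps"
      using that fps_conv_radius_mult[of f g] by (auto intro: less_le_trans[rotated])
    have diff: "ereal \<bar>x\<bar> < fps_conv_radius (f - g)"
      if "ereal \<bar>x\<bar> < fps_conv_radius f" "ereal \<bar>x\<bar> < fps_conv_radius g" for f g :: "real fps"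
      using that fps_conv_radius_diff[of f g] by (auto intro: less_le_trans[rotated])
    note rad = P Q X one pow mult diff
    note ev = eval_fps_mult eval_fps_diff eval_fps_power eval_fps_X eval_fps_1
    show ?thesis
      using arg_cong[OF P_ser_curve, of "\<lambda>f. eval_fps f x"] arg_cong[OF Q_ser_curve, of "\<lambda>f. eval_fps f x"]
      by (simp add: rad ev)
  qed
  have closed_case: "D rho = 0" if "continuous_on {0..rho} D" "\<And>x. 0 \<le> x \<Longrightarrow> x < rho \<Longrightarrow> D x = 0" for D :: "real \<Rightarrow> real"
  proof -
    have "(D \<longlongrightarrow> D rho) (at_left rho)"
      using continuous_on_Icc_at_leftD[OF that(1) rho_nu_bounds(4)] .
    moreover have "\<forall>\<^sub>F x in at_left rho. 0 = D x"
      using eventually_at_left_real[OF rho_nu_bounds(4)] by eventually_elim (simp add: that(2))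
    then have "(D \<longlongrightarrow> 0) (at_left rho)"
      by (rule tendsto_eventually[OF eventually_mono]) simp
    ultimately show ?thesis
      by (rule tendsto_unique[rotated]) simp
  qed
  show "(p - 1) * (1 - x^3 * p^2) = x * p^2"
  proof (cases "x = rho")
    case True
    have "(eval_fps P_ser rho - 1) * (1 - rho^3 * eval_fps P_ser rho^2) - rho * eval_fps P_ser rho^2 = 0"
      by (rule closed_case) (use open_case in \<open>auto intro!: continuous_intros P_ser_at_rho(3)\<close>)
    then show ?thesis by (simp add: True p_def)
  qed (use assms open_case[of x] in auto)
  show "(q - 1) * (1 - x^3 * p^3) = x * p^2"
  proof (cases "x = rho")
    case True
    have "(eval_fps Q_ser rho - 1) * (1 - rho^3 * eval_fps P_ser rho^3) - rho * eval_fps P_ser rho^2 = 0"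
      by (rule closed_case) (use open_case in \<open>auto intro!: continuous_intros P_ser_at_rho(3) Q_ser_at_rho(3)\<close>)
    then show ?thesis by (simp add: True p_def q_def)
  qed (use assms open_case[of x] in auto)
qed

lemma eval_P_ser_rho: "eval_fps P_ser rho = nu / rho"
proof -
  define u where "u = (\<lambda>x. x * eval_fps P_ser x)"
  note b = rho_nu_bounds
  have curve: "(u x - x) * (1 - x * u x^2) = u x^2" if "0 \<le> x" "x \<le> rho" for x
    using eval_ser_curves(1)[OF that] unfolding u_def by algebra
  \<comment> \<open>At \<open>rho\<close> the cubic has the double root \<open>nu\<close> and a root below \<open>-1\<close>; by continuity \<open>u\<close> cannot
    reach the latter.\<close>
  have u_ne: "u x \<noteq> -1" if "0 \<le> x" "x \<le> rho" for x
  proof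
    assume "u x = -1"
    \<comment> \<open>At y = -1 the curve reads (-1 - x)(1 - x) = 1.\<close>
    then have "x^2 = 2" using curve[OF that] by (simp add: algebra_simps power2_eq_square)
    moreover have "x^2 \<le> (1/2)^2" using that b by (intro power_mono) auto
    ultimately show False by (simp add: power_divide)
  qed
  have u_cont: "continuous_on {0..rho} u"
    unfolding u_def by (intro continuous_intros P_ser_at_rho(3))
  have "u rho > -1"
  proof (rule ccontr)
    assume "\<not> u rho > -1"
    then have "\<exists>x\<ge>0. x \<le> rho \<and> u x = -1"
      using b u_cont by (intro IVT2') (auto simp: u_def)
    then show False using u_ne by blast
  qed
  have rho2: "rho^2 < rho"
    using b mult_strict_left_mono[of rho 1 rho] by (simp add: power2_eq_square)
  \<comment> \<open>Taylor expansion of -F(., \<rho>) at \<nu>: the constant and linear coefficients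
    vanish by the two critical equations, which leaves a square times a linear factor.\<close>
  have "(u rho - nu)^2 * (rho * (u rho + 2 * nu) + 1 - rho^2) =
      ((nu - rho) * (1 - rho * nu^2) - nu^2) + (1 - 3 * rho * nu^2 + 2 * rho^2 * nu - 2 * nu) * (u rho - nu)
      - ((u rho - rho) * (1 - rho * u rho^2) - u rho^2)"
    by algebra
  also have "\<dots> = 0"
    using rho_nu_critical curve[of rho] b by simp
  finally have "(u rho - nu)^2 * (rho * (u rho + 2 * nu) + 1 - rho^2) = 0" .
  moreover have "rho * (u rho + 2 * nu) + 1 - rho^2 > 0"
  proof -
    have "rho * (u rho + 2 * nu) \<ge> rho * (-1)"
      using \<open>u rho > -1\<close> b by (intro mult_left_mono) auto
    then show ?thesis using rho2 b by simp
  qed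
  ultimately have "u rho = nu" by simp
  then show ?thesis using b(4) by (simp add: u_def field_simps)
qed

lemma eval_Q_ser_rho: "eval_fps Q_ser rho = 1 + nu^2 / (rho * (1 - nu^3))"
proof -
  note b = rho_nu_bounds
  have "(eval_fps Q_ser rho - 1) * (1 - rho^3 * (nu / rho)^3) = rho * (nu / rho)^2"
    using eval_ser_curves(2)[of rho] b by (simp add: eval_P_ser_rho)
  then have "(eval_fps Q_ser rho - 1) * (1 - nu^3) = nu^2 / rho"
    using b(4) by (simp add: power_divide power2_eq_square)
  then show ?thesis
    using nu_cube_less_1 b(4) by (simp add: field_simps)
qed

lemma sums_eval_fps:
  fixes f :: "real fps"
  assumes "summable (\<lambda>n. norm (fps_nth f n * x ^ n))"
  shows "(\<lambda>n. fps_nth f n * x ^ n) sums eval_fps f x"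
  unfolding eval_fps_def by (rule summable_sums[OF summable_norm_cancel[OF assms]])

theorem theorem2p5:
  shows "fps_conv_radius P_ser = ereal rho \<and>
    fps_conv_radius Q_ser = ereal rho \<and>
    (\<lambda>n. fps_nth P_ser n * rho ^ n) sums (nu / rho) \<and>
    (\<lambda>n. fps_nth Q_ser n * rho ^ n) sums (1 + nu^2 / (rho * (1 - nu^3))) \<and>
    infinite_deriv_at_left (eval_fps P_ser) rho \<and>
    infinite_deriv_at_left (eval_fps Q_ser) rho \<and>
    (\<exists>e \<in> O(\<lambda>n. 1 / real n). \<forall>\<^sub>F n in sequentially.
           fps_nth P_ser n =
             gamma_P * rho powi (- int n) / (sqrt pi * real n powr (3/2)) * (1 + e n)) \<and>
    (\<exists>e \<in> O(\<lambda>n. 1 / real n). \<forall>\<^sub>F n in sequentially.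
           fps_nth Q_ser n =
             gamma_Q * rho powi (- int n) / (sqrt pi * real n powr (3/2)) * (1 + e n))"
  using P_ser_at_rho(2,4) Q_ser_at_rho(2,4) P_ser_asymptotics(1) Q_ser_asymptotics(1)
    sums_eval_fps[OF P_ser_at_rho(1)] sums_eval_fps[OF Q_ser_at_rho(1)]
  unfolding eval_P_ser_rho eval_Q_ser_rho by (intro conjI)

end
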